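(* Let $G=(V,E)$ be the graph with $V=\{1,2,\dots\}$ and $E=\{1u\in V^2:u\ge1\}\cup\{vu\in V^2:u=v-1,\ v\ge2\}$. For each $v\in V$ let $J_v\subset\mathbb{R}^D$ be the closed ball with centre $c_v$ and radius $1/2^v$, and let $O_v=B(c_v,1)$ be the open ball of radius $1$, where the centres $c_v$ are chosen so that $\operatorname{int}J_v\cap\operatorname{int}J_{v'}=\emptyset$ whenever $v\ne v'$. For each $vu\in E$ let $T_{vu}:\mathbb{R}^D\to\mathbb{R}^D$ be a similarity with contraction ratio $(1/2)^v$ satisfying $T_{vu}J_u\subset J_v$, and assume that the open set condition holds, i.e. $T_{vu}(\operatorname{int}J_u)\cap T_{v'u'}(\operatorname{int}J_{u'})=\emptyset$ for distinct edges $vu\ne v'u'$ in $E$. Then the Hausdorff dimension of the limit set $K$ of the system $(G,(J_v),(O_v),(T_e))$ is the unique solution $s$ of the equation $P(s\varphi^V)=0$. In particular, $\underline{I}^V=(0,\infty)$ and $\underline{I}^E=\emptyset$.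
   Context: $D\ge1$ is an integer, $\|\cdot\|$ is the operator norm, and $\|M\|_i:=\|M^{-1}\|^{-1}$ for an invertible matrix $M$. An edge $vu$ has initial vertex $v$ and terminal vertex $u$. Let $X=\{\omega\in V^{\mathbb{Z}_{\ge0}}:\omega_n\omega_{n+1}\in E\ \forall n\ge0\}$, $\sigma$ the shift $(\sigma\omega)_n=\omega_{n+1}$, $\pi:X\to\mathbb{R}^D$ given by $\{\pi\omega\}=\bigcap_{k\ge0}T_{\omega_0\omega_1}\circ\cdots\circ T_{\omega_k\omega_{k+1}}(J_{\omega_{k+1}})$, and $K=\pi(X)$ the limit set. Put $\varphi^V(\omega)=\log\|T_{\omega_0\omega_1}'(\pi\sigma\omega)\|$. For a real function $f$ on $X$, the topological pressure is $P(f)=\lim_{n\to\infty}\frac1n\log\sum_{w\in V^n:[w]\ne\emptyset}\exp(\sup_{\omega\in[w]}\sum_{i=0}^{n-1}f(\sigma^i\omega))$ with $[w]=\{\omega\in X:\omega_0\cdots\omega_{n-1}=w\}$. $\underline{I}^V=\{s\ge0:\sum_{v\in V}\sup_{u:\,vu\in E}\sup_{x\in K\cap J_u}\|T_{vu}'(x)\|_i^s<\infty\}$ and $\underline{I}^E=\{s\ge0:\sum_{vu\in E}\sup_{x\in K\cap J_u}\|T_{vu}'(x)\|_i^s<\infty\}$. *)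

theory Defs
  imports "HOL-Analysis.Analysis"
begin

text \<open>Covering sets are required to be bounded because \<^const>\<open>diameter\<close> is not meaningful on
  unbounded sets. For exponent 0 a nonempty set contributes 1, also when its diameter is 0
  (note that \<open>0 powr 0 = 0\<close> in the library).\<close>

definition diam_pow :: "real \<Rightarrow> 'a::metric_space set \<Rightarrow> ennreal" where
  "diam_pow s U = (if U = {} then 0 else if s = 0 then 1 else ennreal (diameter U powr s))"

definition delta_covers :: "real \<Rightarrow> 'a::metric_space set \<Rightarrow> (nat \<Rightarrow> 'a set) set" where
  "delta_covers \<delta> A = {U. A \<subseteq> (\<Union>i. U i) \<and> (\<forall>i. bounded (U i) \<and> diameter (U i) \<le> \<delta>)}"

definition hausdorff_measure :: "real \<Rightarrow> 'a::metric_space set \<Rightarrow> ennreal" where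
  "hausdorff_measure s A =
     (SUP \<delta>\<in>{0<..}. INF U\<in>delta_covers \<delta> A. \<Sum>\<^sub>\<infinity>i\<in>UNIV. diam_pow s (U i))"

definition hausdorff_dim :: "'a::metric_space set \<Rightarrow> ereal" where
  "hausdorff_dim A = Inf {ereal s | s. 0 \<le> s \<and> hausdorff_measure s A = 0}"

definition op_norm :: "real^'n^'m \<Rightarrow> real" where
  "op_norm M = onorm (\<lambda>x. M *v x)"

definition lower_norm :: "real^'n^'n \<Rightarrow> real" where
  "lower_norm M = inverse (op_norm (matrix_inv M))"

definition similarity :: "real \<Rightarrow> ('a::metric_space \<Rightarrow> 'a) \<Rightarrow> bool" where
  "similarity r f \<longleftrightarrow> 0 < r \<and> (\<forall>x y. dist (f x) (f y) = r * dist x y)"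

text \<open>In \<open>emap S v u\<close> the edge \<open>vu\<close> has initial vertex \<open>v\<close> and terminal vertex \<open>u\<close>. The values of
  \<open>seed\<close>, \<open>nbhd\<close> and \<open>emap\<close> outside the vertices and edges are irrelevant.\<close>

record ('v, 'a) graph_system =
  vertices :: "'v set"
  edges :: "('v \<times> 'v) set"
  seed :: "'v \<Rightarrow> 'a set"
  nbhd :: "'v \<Rightarrow> 'a set"
  emap :: "'v \<Rightarrow> 'v \<Rightarrow> 'a \<Rightarrow> 'a"

definition path_space :: "('v, 'a) graph_system \<Rightarrow> (nat \<Rightarrow> 'v) set" where
  "path_space S = {\<omega>. \<forall>n. \<omega> n \<in> vertices S \<and> (\<omega> n, \<omega> (Suc n)) \<in> edges S}"

definition shift :: "(nat \<Rightarrow> 'v) \<Rightarrow> nat \<Rightarrow> 'v" where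
  "shift \<omega> = (\<lambda>n. \<omega> (Suc n))"

primrec path_map :: "('v, 'a) graph_system \<Rightarrow> (nat \<Rightarrow> 'v) \<Rightarrow> nat \<Rightarrow> 'a \<Rightarrow> 'a" where
  "path_map S \<omega> 0 = emap S (\<omega> 0) (\<omega> 1)"
| "path_map S \<omega> (Suc k) = path_map S \<omega> k \<circ> emap S (\<omega> (Suc k)) (\<omega> (Suc (Suc k)))"

definition coding_map :: "('v, 'a) graph_system \<Rightarrow> (nat \<Rightarrow> 'v) \<Rightarrow> 'a" where
  "coding_map S \<omega> = (THE x. {x} = (\<Inter>k. path_map S \<omega> k ` seed S (\<omega> (Suc k))))"

definition limit_set :: "('v, 'a) graph_system \<Rightarrow> 'a set" where
  "limit_set S = coding_map S ` path_space S"

definition vertex_potential :: "('v, real^'d) graph_system \<Rightarrow> (nat \<Rightarrow> 'v) \<Rightarrow> real" where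
  "vertex_potential S \<omega> =
     ln (op_norm (jacobian (emap S (\<omega> 0) (\<omega> 1)) (at (coding_map S (shift \<omega>)))))"

definition eexp :: "ereal \<Rightarrow> ennreal" where
  "eexp x = (if x = \<infinity> then \<infinity> else if x = -\<infinity> then 0 else ennreal (exp (real_of_ereal x)))"

definition eln :: "ennreal \<Rightarrow> ereal" where
  "eln x = (if x = \<infinity> then \<infinity> else if x = 0 then -\<infinity> else ereal (ln (enn2real x)))"

definition cylinder :: "('v, 'a) graph_system \<Rightarrow> 'v list \<Rightarrow> (nat \<Rightarrow> 'v) set" where
  "cylinder S w = {\<omega> \<in> path_space S. map \<omega> [0..<length w] = w}"

definition partition_sum ::
    "('v, 'a) graph_system \<Rightarrow> ((nat \<Rightarrow> 'v) \<Rightarrow> real) \<Rightarrow> nat \<Rightarrow> ennreal" where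
  "partition_sum S f n =
     (\<Sum>\<^sub>\<infinity>w\<in>{w. length w = n \<and> set w \<subseteq> vertices S \<and> cylinder S w \<noteq> {}}.
        eexp (SUP \<omega>\<in>cylinder S w. ereal (\<Sum>i<n. f ((shift ^^ i) \<omega>))))"

text \<open>The vertex set may be infinite, so the pressure takes values in the extended reals.\<close>

definition pressure :: "('v, 'a) graph_system \<Rightarrow> ((nat \<Rightarrow> 'v) \<Rightarrow> real) \<Rightarrow> ereal" where
  "pressure S f = lim (\<lambda>n. ereal (1 / real n) * eln (partition_sum S f n))"

definition edge_weight :: "('v, real^'d) graph_system \<Rightarrow> real \<Rightarrow> 'v \<Rightarrow> 'v \<Rightarrow> ennreal" where
  "edge_weight S s v u =
     (SUP x\<in>limit_set S \<inter> seed S u. ennreal (lower_norm (jacobian (emap S v u) (at x)) powr s))"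

definition I_vertex :: "('v, real^'d) graph_system \<Rightarrow> real set" where
  "I_vertex S =
     {s. 0 \<le> s \<and> (\<Sum>\<^sub>\<infinity>v\<in>vertices S. SUP u\<in>{u. (v, u) \<in> edges S}. edge_weight S s v u) < \<infinity>}"

definition I_edge :: "('v, real^'d) graph_system \<Rightarrow> real set" where
  "I_edge S = {s. 0 \<le> s \<and> (\<Sum>\<^sub>\<infinity>(v, u)\<in>edges S. edge_weight S s v u) < \<infinity>}"

end

theory Submission
  imports Defs "HOL-Library.Sublist"
begin

text \<open>
  Every map of the system is a similarity whose ratio depends on its initial vertex only. Push the
  ball \<open>J\<^sub>v\<close> of the last vertex of a walk along the walk: the result, the cell of the walk
  \<open>v\<^sub>0 \<dots> v\<^sub>n\<close>, is a ball of radius \<open>2 powr - (v\<^sub>0 + \<dots> + v\<^sub>n)\<close>. With \<open>x = 2 powr - t\<close>, both the partition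
  sums of \<open>t \<phi>\<close> and the sums of \<open>t\<close>-th powers of cell diameters are therefore, up to a constant, the
  weighted counts \<open>Z\<^sub>n\<close> of the walks of \<open>n + 1\<close> vertices, where a walk with vertex sum \<open>k\<close> has weight
  \<open>x ^ k\<close> (\<open>total_sum\<close> below).

  The growth of \<open>Z\<^sub>n\<close> is found from an explicit eigenvector of the transfer operator
  \<open>f \<mapsto> (\<lambda>v. x ^ v * (sum of f over the successors of v))\<close>. Write \<open>\<tau> v = 1 + \<dots> + v\<close>, let \<open>y > 0\<close> be
  the number for which the \<open>x ^ \<tau> v * y ^ v\<close> with \<open>v \<ge> 1\<close> add up to \<open>1\<close>, and put \<open>h v = x ^ \<tau> v * y ^ v\<close>.
  Then the sum of \<open>h\<close> over the successors of \<open>v\<close> is \<open>h (v - 1)\<close> for every \<open>v\<close>: for \<open>v \<ge> 2\<close> the only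
  successor is \<open>v - 1\<close>, and for \<open>v = 1\<close> the sum is \<open>1 = h 0\<close>. As \<open>h v = x ^ v * y * h (v - 1)\<close>, the
  eigenvalue is \<open>1 / y\<close>. Comparing \<open>Z\<^sub>n\<close> with \<open>h\<close> gives \<open>y ^ - (n + 1) \<le> Z\<^sub>n \<le> C * y ^ - n\<close>
  (\<open>total_sum_ge\<close>, \<open>total_sum_le\<close>), so the pressure of \<open>t \<phi>\<close> is \<open>- ln y\<close> for \<open>t > 0\<close>, and it is
  \<open>\<infinity>\<close> for \<open>t \<le> 0\<close>. Since \<open>y\<close> strictly increases with \<open>t\<close>, the pressure vanishes for exactly one \<open>s\<close>,
  the one for which the numbers \<open>2 powr - (s * \<tau> v)\<close> with \<open>v \<ge> 1\<close> add up to \<open>1\<close>.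

  For \<open>t > s\<close> the cells of the walks of \<open>n + 1\<close> vertices cover \<open>K\<close>, they shrink uniformly, and the
  \<open>t\<close>-th powers of their diameters add up to \<open>2 powr t * Z\<^sub>n \<rightarrow> 0\<close>; so the dimension is at most \<open>s\<close>.

  For \<open>0 \<le> t < s\<close> some \<open>N\<close> has \<open>x ^ \<tau> 1 + \<dots> + x ^ \<tau> N \<ge> 1\<close>. Keep only the vertices up to \<open>N\<close>
  and give a walk \<open>v\<^sub>0 \<dots> v\<^sub>n\<close> the mass \<open>x ^ (v\<^sub>0 + \<dots> + v\<^bsub>n-1\<^esub> + \<tau> v\<^sub>n)\<close>, which is at most the sum of the
  masses of its one-step extensions. A set of walks that contains an initial piece of every path from \<open>1\<close>
  then has total mass at least \<open>x\<close>: otherwise one could always extend a walk so that its mass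
  exceeds the total mass of the members of the set below it, and the path so obtained would avoid the set
  (\<open>mass_cover_ge\<close>). On the other hand, a covering set \<open>U\<close> of diameter at most \<open>d\<close> meets a bounded number of
  cells of the walks that are stopped once their radius is at most \<open>d\<close>: these balls have radii comparable
  to \<open>d\<close>, and by the open set condition their interiors are disjoint (\<open>card_stopping_cells_le\<close>). Each
  of these walks has mass at most \<open>d powr t\<close>. Hence the
  \<open>t\<close>-th powers of the diameters in any cover of \<open>K\<close> add up to at least a positive constant.

  Finally, in \<open>I\<^sup>V\<close> the vertex \<open>v\<close> contributes \<open>2 powr - (v * s)\<close>, a geometric series, while in
  \<open>I\<^sup>E\<close> the infinitely many edges that leave the vertex \<open>1\<close> contribute \<open>2 powr - s\<close> each.
\<close>

section \<open>Sums of extended nonnegative reals\<close>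

lemma infsum_ennreal_nat: "infsum f (UNIV::nat set) = suminf (f :: nat \<Rightarrow> ennreal)"
  by (metis has_sum_imp_sums has_sum_infsum nonneg_summable_on_complete sums_unique zero_le)

text \<open>Reading an unordered sum as a measure of its index set makes the additivity and the subadditivity
  of measures available for such sums.\<close>
lemma infsum_ennreal_eq_emeasure:
  fixes f :: "'a::countable \<Rightarrow> ennreal"
  shows "infsum f A = emeasure (density (count_space UNIV) f) A"
proof -
  define g where "g n = (if n \<in> to_nat ` A then f (from_nat n) else 0)" for n
  have "infsum f A = infsum (g \<circ> to_nat) A"
    by (intro infsum_cong) (auto simp: g_def)
  also have "\<dots> = infsum g (to_nat ` A)"
    by (intro infsum_reindex [symmetric]) auto
  also have "\<dots> = infsum g UNIV"
    by (intro infsum_cong_neutral) (auto simp: g_def)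
  also have "\<dots> = suminf g"
    by (rule infsum_ennreal_nat)
  also have "\<dots> = (\<integral>\<^sup>+n. g n \<partial>count_space UNIV)"
    by (simp add: nn_integral_count_space_nat)
  also have "\<dots> = (\<integral>\<^sup>+n. g n \<partial>count_space (to_nat ` A))"
    by (intro nn_integral_count_space_eq) (auto simp: g_def)
  also have "\<dots> = (\<integral>\<^sup>+a. g (to_nat a) \<partial>count_space A)"
    by (intro nn_integral_bij_count_space[symmetric]) (auto simp: bij_betw_def)
  also have "\<dots> = (\<integral>\<^sup>+a. f a \<partial>count_space A)"
    by (intro nn_integral_cong) (auto simp: g_def)
  also have "\<dots> = (\<integral>\<^sup>+a. f a * indicator A a \<partial>count_space UNIV)"
    by (simp add: nn_integral_count_space_indicator)
  also have "\<dots> = emeasure (density (count_space UNIV) f) A"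
    by (simp add: emeasure_density)
  finally show ?thesis .
qed

lemma infsum_ennreal_UN_disjoint:
  fixes f :: "'a::countable \<Rightarrow> ennreal"
  assumes "disjoint_family A"
  shows "infsum f (\<Union>i::nat. A i) = (\<Sum>i. infsum f (A i))"
  unfolding infsum_ennreal_eq_emeasure
  by (rule suminf_emeasure[symmetric]) (use assms in auto)

lemma infsum_ennreal_UN_le:
  fixes f :: "'a::countable \<Rightarrow> ennreal"
  shows "infsum f (\<Union>i::nat. A i) \<le> (\<Sum>i. infsum f (A i))"
  unfolding infsum_ennreal_eq_emeasure
  by (rule emeasure_subadditive_countably) auto

lemma infsum_ennreal_subset:
  fixes f :: "'a \<Rightarrow> ennreal"
  assumes "A \<subseteq> B"
  shows "infsum f A \<le> infsum f B"
  by (rule infsum_mono_neutral) (use assms in \<open>auto intro: nonneg_summable_on_complete\<close>)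

lemma infsum_ennreal_cmult:
  fixes f :: "'a::countable \<Rightarrow> ennreal"
  shows "infsum (\<lambda>w. c * f w) A = c * infsum f A"
  unfolding infsum_ennreal_eq_emeasure
  by (simp add: emeasure_density nn_integral_cmult mult.assoc)

section \<open>Walks in the graph and their weighted counts\<close>

definition edge :: "nat \<Rightarrow> nat \<Rightarrow> bool" where
  "edge v u \<longleftrightarrow> (v = 1 \<and> 1 \<le> u) \<or> (2 \<le> v \<and> u = v - 1)"

lemma edge_ge_1: "edge v u \<Longrightarrow> 1 \<le> v \<and> 1 \<le> u"
  by (auto simp: edge_def)

definition is_walk :: "nat list \<Rightarrow> bool" where
  "is_walk w \<longleftrightarrow> w \<noteq> [] \<and> 1 \<le> hd w \<and> successively edge w"

lemma is_walk_simps [simp]: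
  "\<not> is_walk []"
  "is_walk [v] \<longleftrightarrow> 1 \<le> v"
  "is_walk (v # u # ws) \<longleftrightarrow> edge v u \<and> is_walk (u # ws)"
  using edge_ge_1 by (auto simp: is_walk_def)

lemma is_walk_set: "is_walk w \<Longrightarrow> v \<in> set w \<Longrightarrow> 1 \<le> v"
  by (induction w rule: induct_list012) (auto dest: edge_ge_1)

lemma is_walk_snoc: "is_walk a \<Longrightarrow> edge (last a) u \<Longrightarrow> is_walk (a @ [u])"
  by (auto simp: is_walk_def successively_append_iff)

definition walks :: "nat \<Rightarrow> nat list set" where
  "walks n = {w. length w = Suc n \<and> is_walk w}"

definition walks_from :: "nat \<Rightarrow> nat \<Rightarrow> nat list set" where
  "walks_from n v = {w \<in> walks n. hd w = v}"

definition walk_sum :: "real \<Rightarrow> nat \<Rightarrow> nat \<Rightarrow> ennreal" where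
  "walk_sum x n v = (\<Sum>\<^sub>\<infinity>w\<in>walks_from n v. ennreal (x ^ sum_list w))"

definition total_sum :: "real \<Rightarrow> nat \<Rightarrow> ennreal" where
  "total_sum x n = (\<Sum>\<^sub>\<infinity>w\<in>walks n. ennreal (x ^ sum_list w))"

definition triangular :: "nat \<Rightarrow> nat" where "triangular n = \<Sum>{..n}"

lemma triangular_simps [simp]: "triangular 0 = 0" "triangular (Suc n) = triangular n + Suc n"
  by (simp_all add: triangular_def)

lemma le_triangular: "n \<le> triangular n"
  by (induction n) auto

text \<open>Sorting walks by their first vertex turns the count into an ordinary series, to which the
  recursion over the first step applies.\<close>
lemma total_sum_eq: "total_sum x n = (\<Sum>v. walk_sum x n (Suc v))"
proof -
  have "walks n = (\<Union>v. walks_from n (Suc v))"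
    by (auto simp: walks_def walks_from_def is_walk_def Suc_le_eq gr0_conv_Suc)
  moreover have "disjoint_family (\<lambda>v. walks_from n (Suc v))"
    by (auto simp: disjoint_family_on_def walks_from_def)
  ultimately show ?thesis
    unfolding total_sum_def walk_sum_def by (simp add: infsum_ennreal_UN_disjoint)
qed

lemma walk_sum_0: "1 \<le> v \<Longrightarrow> walk_sum x 0 v = ennreal (x ^ v)"
proof -
  assume "1 \<le> v"
  then have "walks_from 0 v = {[v]}"
    by (auto simp: walks_from_def walks_def length_Suc_conv)
  then show ?thesis by (simp add: walk_sum_def)
qed

lemma infsum_walk_Cons:
  assumes "0 \<le> x"
  shows "(\<Sum>\<^sub>\<infinity>w\<in>(#) v ` W. ennreal (x ^ sum_list w))
    = ennreal (x ^ v) * (\<Sum>\<^sub>\<infinity>w\<in>W. ennreal (x ^ sum_list w))"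
proof -
  have "(\<Sum>\<^sub>\<infinity>w\<in>(#) v ` W. ennreal (x ^ sum_list w))
      = (\<Sum>\<^sub>\<infinity>w\<in>W. ennreal (x ^ v) * ennreal (x ^ sum_list w))"
    using assms by (subst infsum_reindex) (auto simp: o_def power_add ennreal_mult)
  then show ?thesis by (simp add: infsum_ennreal_cmult)
qed

lemma walk_sum_Suc_1:
  assumes "0 \<le> x"
  shows "walk_sum x (Suc n) (Suc 0) = ennreal x * total_sum x n"
proof -
  have "walks_from (Suc n) (Suc 0) = (#) 1 ` walks n"
    by (auto simp: walks_from_def walks_def length_Suc_conv edge_def is_walk_def)
  then show ?thesis
    using infsum_walk_Cons[OF assms, of 1] by (simp add: walk_sum_def total_sum_def)
qed

lemma walk_sum_Suc_Suc:
  assumes "0 \<le> x"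
  shows "walk_sum x (Suc n) (Suc (Suc v)) = ennreal (x ^ Suc (Suc v)) * walk_sum x n (Suc v)"
proof -
  have "walks_from (Suc n) (Suc (Suc v)) = (#) (Suc (Suc v)) ` walks_from n (Suc v)"
    by (auto simp: walks_from_def walks_def length_Suc_conv edge_def is_walk_def)
  then show ?thesis
    using infsum_walk_Cons[OF assms, of "Suc (Suc v)"] by (simp add: walk_sum_def)
qed

section \<open>Exponential growth of the weighted counts\<close>

text \<open>The equation for \<open>y\<close> says that \<open>1 / y\<close> is the eigenvalue of the transfer operator with weights \<open>x ^ v\<close>
  that belongs to the positive eigenvector \<open>h\<close> below.\<close>
locale weight_eigenvalue =
  fixes x y :: real
  assumes x: "0 < x" "x < 1" and y: "0 < y"
    and sums_h: "(\<lambda>v. x ^ triangular (Suc v) * y ^ Suc v) sums 1"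
begin

definition h :: "nat \<Rightarrow> real" where "h v = x ^ triangular v * y ^ v"

lemma h_0 [simp]: "h 0 = 1" by (simp add: h_def)
lemma h_Suc: "h (Suc v) = x ^ Suc v * y * h v" by (simp add: h_def power_add)
lemma h_pos: "0 < h v" using x y by (simp add: h_def)
lemma h_sums: "(\<lambda>v. h (Suc v)) sums 1" using sums_h by (simp add: h_def)

lemma sum_h_le_1: "(\<Sum>v<n. h (Suc v)) \<le> 1"
  using sum_le_suminf[of "\<lambda>v. h (Suc v)" "{..<n}"] h_sums h_pos by (auto simp: sums_iff less_imp_le)

lemma h_le_1: "h v \<le> 1"
proof (cases v)
  case (Suc u)
  have "h (Suc u) \<le> (\<Sum>v<Suc u. h (Suc v))"
    using h_pos by (intro member_le_sum) (auto simp: less_imp_le)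
  with sum_h_le_1[of "Suc u"] Suc show ?thesis by simp
qed simp

lemma suminf_h: "(\<Sum>v. ennreal (c * h (Suc v))) = ennreal c" if "0 \<le> c"
proof -
  have "(\<lambda>v. c * h (Suc v)) sums (c * 1)" by (intro sums_mult h_sums)
  then show ?thesis
    using that h_pos by (subst suminf_ennreal2) (auto simp: sums_iff less_imp_le)
qed

text \<open>The eigenvector \<open>h\<close> lies below the one-vertex sums up to the factor \<open>y\<close>, as \<open>h \<le> 1\<close>; applying the
  transfer operator \<open>n\<close> times preserves this and multiplies \<open>h\<close> by \<open>(1 / y) ^ n\<close>.\<close>
lemma walk_sum_ge: "ennreal ((1 / y) ^ Suc n * h (Suc v)) \<le> walk_sum x n (Suc v)"
proof (induction n arbitrary: v)
  case 0
  have "(1 / y) * h (Suc v) = x ^ Suc v * h v"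
    using y by (simp add: h_Suc)
  also have "\<dots> \<le> x ^ Suc v"
    using h_le_1 x by (intro mult_left_le) auto
  finally show ?case
    using x by (auto simp: walk_sum_0 intro!: ennreal_leI)
next
  case (Suc n)
  have tot: "ennreal ((1 / y) ^ Suc n) \<le> total_sum x n"
    unfolding total_sum_eq using suminf_h[of "(1/y) ^ Suc n"] y
    by (metis Suc suminf_le summableI zero_le_divide_1_iff zero_le_power less_imp_le)
  show ?case
  proof (cases v)
    case 0
    have "ennreal ((1 / y) ^ Suc (Suc n) * h (Suc 0)) = ennreal x * ennreal ((1 / y) ^ Suc n)"
      using x y by (simp add: h_Suc flip: ennreal_mult)
    with tot x 0 show ?thesis by (simp add: walk_sum_Suc_1 mult_left_mono)
  next
    case (Suc u)
    have "ennreal ((1 / y) ^ Suc (Suc n) * h (Suc (Suc u)))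
          = ennreal (x ^ Suc (Suc u)) * ennreal ((1 / y) ^ Suc n * h (Suc u))"
      using x y h_pos[of "Suc u"] by (subst h_Suc) (simp flip: ennreal_mult)
    with Suc.IH[of u] x Suc show ?thesis by (simp add: walk_sum_Suc_Suc mult_left_mono del: power_Suc)
  qed
qed

lemma total_sum_ge: "ennreal ((1 / y) ^ Suc n) \<le> total_sum x n"
  unfolding total_sum_eq using suminf_h[of "(1/y) ^ Suc n"] y
    by (metis walk_sum_ge suminf_le summableI zero_le_divide_1_iff zero_le_power less_imp_le)

text \<open>The first summand settles one-vertex walks. The second one is large enough for the walks
  too short to reach \<open>1\<close> to be absorbed into the multiple of \<open>h\<close> that bounds the others, see
  \<open>total_sum_le_aux\<close>.\<close>
definition C :: real where "C = 1 / y + 1 / (x * (1 - x) * y\<^sup>2)"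

lemma C_pos: "0 < C" using x y by (auto simp: C_def intro!: add_pos_pos)

text \<open>A constant multiple of \<open>h\<close> cannot bound all one-vertex sums from above, because \<open>h v\<close> decays
  like \<open>x ^ (v\<^sup>2 / 2)\<close>. But \<open>n\<close> steps from a start above \<open>n + 1\<close> only descend, so that sum is a single
  product, and for the start \<open>n + 2\<close> its exponent of \<open>x\<close> is only one less than that in \<open>h (n + 2)\<close>.\<close>
lemma walk_sum_far: "walk_sum x n (n + 2 + m) \<le> ennreal (x ^ (triangular (n + 1) + n + 1 + m))"
proof (induction n arbitrary: m)
  case 0
  show ?case by (simp add: walk_sum_0)
next
  case (Suc n)
  have "walk_sum x (Suc n) (Suc n + 2 + m) = ennreal (x ^ (Suc n + 2 + m)) * walk_sum x n (n + 2 + m)"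
    using walk_sum_Suc_Suc[of x n "n + 1 + m"] x by simp
  also have "\<dots> \<le> ennreal (x ^ (Suc n + 2 + m)) * ennreal (x ^ (triangular (n + 1) + n + 1 + m))"
    by (intro mult_left_mono Suc) auto
  also have "\<dots> = ennreal (x ^ (Suc n + 2 + m + (triangular (n + 1) + n + 1 + m)))"
    using x by (simp add: power_add ennreal_mult mult_ac)
  also have "\<dots> \<le> ennreal (x ^ (triangular (Suc n + 1) + Suc n + 1 + m))"
    using x by (intro ennreal_leI power_decreasing) auto
  finally show ?case .
qed

text \<open>The starts above \<open>n + 1\<close> contribute a geometric series bounded by the term that \<open>h (n + 2)\<close> would
  contribute, and the values of \<open>h\<close> at \<open>1, 2, \<dots>\<close> add up to \<open>1\<close>.\<close>
lemma total_sum_le_aux: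
  assumes "\<And>v. v < Suc n \<Longrightarrow> walk_sum x n (Suc v) \<le> ennreal (C * (1 / y) ^ n * h (Suc v))"
  shows "total_sum x n \<le> ennreal (C * (1 / y) ^ n)"
proof -
  let ?e = "triangular (n + 1) + n + 1"
  have geo: "(\<lambda>m. x ^ (?e + m)) sums (x ^ ?e * (1 / (1 - x)))"
    unfolding power_add using x by (intro sums_mult geometric_sums) auto
  have "total_sum x n = (\<Sum>v. walk_sum x n (Suc (v + Suc n))) + (\<Sum>v<Suc n. walk_sum x n (Suc v))"
    unfolding total_sum_eq by (rule suminf_offset) auto
  also have "(\<Sum>v<Suc n. walk_sum x n (Suc v)) \<le> (\<Sum>v<Suc n. ennreal (C * (1 / y) ^ n * h (Suc v)))"
    by (intro sum_mono assms) auto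
  also have "\<dots> = ennreal (C * (1 / y) ^ n * (\<Sum>v<Suc n. h (Suc v)))"
    unfolding sum_distrib_left using C_pos y h_pos by (intro sum_ennreal) (auto simp: less_imp_le)
  also have "(\<Sum>v. walk_sum x n (Suc (v + Suc n))) \<le> (\<Sum>m. ennreal (x ^ (?e + m)))"
    using walk_sum_far[of n] by (intro suminf_le) (auto simp: add_ac)
  also have "\<dots> = ennreal (x ^ ?e * (1 / (1 - x)))"
    using geo x by (subst suminf_ennreal2) (auto simp: sums_iff)
  also have "x ^ ?e * (1 / (1 - x)) \<le> C * (1 / y) ^ n * h (Suc (Suc n))"
  proof -
    have "C * (1 / y) ^ n * h (Suc (Suc n)) = C * x * y\<^sup>2 * x ^ ?e"
      using y by (simp add: h_def power_add power_divide field_simps power2_eq_square)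
    moreover have "1 / (1 - x) \<le> C * x * y\<^sup>2"
    proof -
      have "C * x * y\<^sup>2 = x * y + 1 / (1 - x)"
        using x y by (simp add: C_def field_simps power2_eq_square)
      then show ?thesis using x y by simp
    qed
    ultimately show ?thesis
      using x by (metis mult.commute mult_left_mono less_imp_le zero_less_power)
  qed
  also have "ennreal (C * (1 / y) ^ n * h (Suc (Suc n))) + ennreal (C * (1 / y) ^ n * (\<Sum>v<Suc n. h (Suc v)))
     = ennreal (C * (1 / y) ^ n * (\<Sum>v<Suc (Suc n). h (Suc v)))"
    using C_pos y h_pos by (subst ennreal_plus[symmetric]) (auto simp: less_imp_le sum_nonneg algebra_simps)
  also have "C * (1 / y) ^ n * (\<Sum>v<Suc (Suc n). h (Suc v)) \<le> C * (1 / y) ^ n * 1"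
    using C_pos y by (intro mult_left_mono sum_h_le_1) auto
  finally show ?thesis by (simp add: add_mono ennreal_leI)
qed

lemma walk_sum_near: "v < Suc n \<Longrightarrow> walk_sum x n (Suc v) \<le> ennreal (C * (1 / y) ^ n * h (Suc v))"
proof (induction n arbitrary: v)
  case 0
  have "x = (1 / y) * h (Suc 0)" using y by (simp add: h_def)
  also have "\<dots> \<le> C * h (Suc 0)"
    using x y h_pos by (intro mult_right_mono) (auto simp: C_def less_imp_le)
  finally show ?case using 0 by (auto simp: walk_sum_0 intro!: ennreal_leI)
next
  case (Suc n)
  show ?case
  proof (cases v)
    case 0
    have "walk_sum x (Suc n) (Suc v) \<le> ennreal x * ennreal (C * (1 / y) ^ n)"
      using 0 x total_sum_le_aux[OF Suc.IH] by (auto simp: walk_sum_Suc_1 intro!: mult_left_mono)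
    also have "\<dots> = ennreal (C * (1 / y) ^ Suc n * h (Suc v))"
      using 0 x y C_pos by (simp add: h_def flip: ennreal_mult)
    finally show ?thesis .
  next
    case (Suc u)
    have "walk_sum x (Suc n) (Suc v) \<le> ennreal (x ^ Suc v) * ennreal (C * (1 / y) ^ n * h (Suc u))"
      using Suc x Suc.prems Suc.IH[of u] by (auto simp: walk_sum_Suc_Suc intro!: mult_left_mono)
    also have "\<dots> = ennreal (C * (1 / y) ^ Suc n * h (Suc v))"
      using Suc x y C_pos h_pos[of "Suc u"] h_Suc[of "Suc u"] by (simp flip: ennreal_mult)
    finally show ?thesis .
  qed
qed

lemma total_sum_le: "total_sum x n \<le> ennreal (C * (1 / y) ^ n)"
  by (rule total_sum_le_aux) (rule walk_sum_near)

end

lemma continuous_on_suminf_dominated: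
  fixes g :: "nat \<Rightarrow> 'a::topological_space \<Rightarrow> real"
  assumes "\<And>n. continuous_on S (g n)" "\<And>n z. z \<in> S \<Longrightarrow> norm (g n z) \<le> M n" "summable M"
  shows "continuous_on S (\<lambda>z. \<Sum>n. g n z)"
proof (rule uniform_limit_theorem)
  show "uniform_limit S (\<lambda>n z. \<Sum>i<n. g i z) (\<lambda>z. \<Sum>n. g n z) sequentially"
    by (rule Weierstrass_m_test) (use assms in auto)
qed (auto intro!: always_eventually continuous_intros assms)

lemma summable_triangular:
  fixes x y :: real
  assumes "0 \<le> x" "x < 1" "0 \<le> y"
  shows "summable (\<lambda>v. x ^ triangular (Suc v) * y ^ Suc v)"
proof -
  have "(\<lambda>n. x ^ n * y) \<longlonglongrightarrow> 0"
    using assms by (auto intro!: tendsto_eq_intros LIMSEQ_power_zero)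
  then have "\<forall>\<^sub>F n in sequentially. x ^ n * y < 1 / 2"
    by (rule order_tendstoD) simp
  then obtain N where N: "\<And>n. n \<ge> N \<Longrightarrow> x ^ n * y < 1 / 2"
    by (auto simp: eventually_sequentially)
  show ?thesis
  proof (rule summable_ratio_test)
    show "norm (x ^ triangular (Suc (Suc n)) * y ^ Suc (Suc n)) \<le> 1 / 2 * norm (x ^ triangular (Suc n) * y ^ Suc n)"
      if "N \<le> n" for n
    proof -
      have "x ^ triangular (Suc (Suc n)) * y ^ Suc (Suc n) = (x ^ Suc (Suc n) * y) * (x ^ triangular (Suc n) * y ^ Suc n)"
        by (simp add: power_add)
      also have "\<dots> \<le> (1 / 2) * (x ^ triangular (Suc n) * y ^ Suc n)"
        using that N[of "Suc (Suc n)"] assms by (intro mult_right_mono) auto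
      finally show ?thesis using assms by simp
    qed
  qed simp
qed

lemma ex_weight_eigenvalue:
  assumes "0 < x" "x < 1"
  shows "\<exists>y. weight_eigenvalue x y"
proof -
  let ?f = "\<lambda>y. \<Sum>v. x ^ triangular (Suc v) * y ^ Suc v"
  have cont: "continuous_on {0..1 / x} ?f"
  proof (rule continuous_on_suminf_dominated)
    show "norm (x ^ triangular (Suc n) * z ^ Suc n) \<le> x ^ triangular (Suc n) * (1 / x) ^ Suc n"
      if "z \<in> {0..1 / x}" for n z
    proof -
      have "z ^ Suc n \<le> (1 / x) ^ Suc n" using that by (intro power_mono) auto
      then show ?thesis
        using that assms by (simp add: norm_mult norm_power mult_left_mono del: triangular_simps power_Suc)
    qed
    show "summable (\<lambda>n. x ^ triangular (Suc n) * (1 / x) ^ Suc n)"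
      using assms by (intro summable_triangular) auto
  qed (intro continuous_intros)
  have "?f (1 / x) \<ge> (\<Sum>v<1. x ^ triangular (Suc v) * (1 / x) ^ Suc v)"
    using assms by (intro sum_le_suminf summable_triangular) auto
  then have "1 \<le> ?f (1 / x)" using assms by simp
  then obtain y where y: "0 \<le> y" "y \<le> 1 / x" "?f y = 1"
    using IVT'[of ?f 0 1 "1 / x", OF _ _ _ cont] assms by auto
  have "y \<noteq> 0" using y(3) by auto
  then show ?thesis
    using y assms summable_triangular[of x y]
    by (intro exI[of _ y]) (auto simp: weight_eigenvalue_def sums_iff simp del: triangular_simps power_Suc)
qed

text \<open>The numbers \<open>7 / 10\<close> and \<open>2\<close> in the proof are chosen because \<open>7 / 10 + (7 / 10) ^ 3 \<ge> 1\<close>, so that the series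
  already exceeds \<open>1\<close> at \<open>7 / 10\<close>.\<close>
lemma ex_critical_weight: "\<exists>x. weight_eigenvalue x 1"
proof -
  let ?f = "\<lambda>x::real. \<Sum>v. x ^ triangular (Suc v)"
  have cont: "continuous_on {0..7 / 10} ?f"
  proof (rule continuous_on_suminf_dominated)
    show "norm (z ^ triangular (Suc n)) \<le> (7 / 10) ^ triangular (Suc n)"
      if "z \<in> {0..7 / 10}" for n and z :: real
      using that power_mono[of z "7 / 10" "triangular (Suc n)"] by (simp add: norm_power del: triangular_simps)
    show "summable (\<lambda>n. (7 / 10 :: real) ^ triangular (Suc n))"
      using summable_triangular[of "7/10" 1] by simp
  qed (intro continuous_intros)
  have "?f (7 / 10) \<ge> (\<Sum>v<2. (7 / 10) ^ triangular (Suc v))"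
    using summable_triangular[of "7/10" 1] by (intro sum_le_suminf) auto
  moreover have "(\<Sum>v<2. (7 / 10 :: real) ^ triangular (Suc v)) \<ge> 1"
    by (simp add: numeral_2_eq_2 lessThan_Suc power_numeral_reduce field_simps)
  ultimately have "1 \<le> ?f (7 / 10)" by linarith
  then obtain x where x: "0 \<le> x" "x \<le> 7 / 10" "?f x = 1"
    using IVT'[of ?f 0 1 "7 / 10", OF _ _ _ cont] by auto
  have "x \<noteq> 0" using x(3) by auto
  then show ?thesis
    using x summable_triangular[of x 1]
    by (intro exI[of _ x]) (auto simp: weight_eigenvalue_def sums_iff simp del: triangular_simps)
qed

text \<open>If \<open>y\<close> did not decrease while \<open>x\<close> grows, no term of the series would decrease and the first one
  would grow, but the sum is \<open>1\<close> in both cases.\<close>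
lemma weight_eigenvalue_antimono:
  assumes "weight_eigenvalue x y" "weight_eigenvalue x' y'" "x < x'"
  shows "y' < y"
proof (rule ccontr)
  assume "\<not> y' < y"
  then have le: "y \<le> y'" by simp
  interpret a: weight_eigenvalue x y by fact
  interpret b: weight_eigenvalue x' y' by fact
  let ?d = "\<lambda>v. x' ^ triangular (Suc v) * y' ^ Suc v - x ^ triangular (Suc v) * y ^ Suc v"
  have "?d sums (1 - 1)" by (intro sums_diff a.sums_h b.sums_h)
  moreover have nonneg: "0 \<le> ?d v" for v
    using a.x a.y b.x b.y le assms(3)
    by (auto simp del: triangular_simps power_Suc intro!: mult_mono power_mono)
  ultimately have "\<forall>v. ?d v = 0"
    using suminf_eq_zero_iff[of ?d] by (simp add: sums_iff del: triangular_simps power_Suc)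
  then have "?d 0 = 0" by (rule spec)
  moreover have "x * y < x' * y'"
    using a.x a.y b.x b.y le assms(3) by (intro mult_less_le_imp_less) auto
  ultimately show False by simp
qed

text \<open>Each of the infinitely many starts contributes at least \<open>1\<close>.\<close>
lemma total_sum_eq_top:
  assumes "1 \<le> x"
  shows "total_sum x n = \<infinity>"
proof -
  have step: "(\<Sum>v. f (Suc v)) = \<infinity>" if "\<And>v. 1 \<le> f (Suc v)" for f :: "nat \<Rightarrow> ennreal"
  proof -
    have "(\<Sum>v. (1::ennreal)) \<le> (\<Sum>v. f (Suc v))"
      using that by (intro suminf_le) auto
    moreover have "(\<Sum>v::nat. (1::ennreal)) = \<infinity>"
      using nn_integral_count_space_nat[of "\<lambda>_. 1"] by simp
    ultimately show ?thesis by (simp add: top_unique)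
  qed
  have "1 \<le> walk_sum x n (Suc v)" for v
  proof (induction n arbitrary: v)
    case 0
    show ?case using assms by (simp add: walk_sum_0 one_le_power del: power_Suc)
  next
    case (Suc n)
    have tot: "total_sum x n = \<infinity>"
      unfolding total_sum_eq by (rule step) (rule Suc)
    show ?case
    proof (cases v)
      case 0
      with tot assms show ?thesis by (simp add: walk_sum_Suc_1 ennreal_mult_top)
    next
      case (Suc u)
      have "1 * 1 \<le> ennreal (x ^ Suc (Suc u)) * walk_sum x n (Suc u)"
        using assms Suc.IH[of u] by (intro mult_mono) (auto simp: one_le_power simp del: power_Suc)
      with Suc assms show ?thesis by (simp add: walk_sum_Suc_Suc)
    qed
  qed
  then show ?thesis unfolding total_sum_eq by (rule step)
qed

text \<open>Already the first term of the series exceeds its critical value by \<open>x - x\<^sub>0\<close>, so a partial sum that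
  misses the critical sum by less than that suffices. This argument also covers \<open>x \<ge> 1\<close>, where the
  series diverges.\<close>
lemma ex_partial_sum_ge_1:
  assumes "weight_eigenvalue x\<^sub>0 1" "x\<^sub>0 < x"
  shows "\<exists>N. 1 \<le> (\<Sum>u=1..N. x ^ triangular u)"
proof -
  interpret weight_eigenvalue x\<^sub>0 1 by fact
  have "(\<lambda>N. \<Sum>v<N. x\<^sub>0 ^ triangular (Suc v)) \<longlonglongrightarrow> 1"
    using sums_h by (simp add: sums_def)
  then have "\<forall>\<^sub>F N in sequentially. 1 - (x - x\<^sub>0) < (\<Sum>v<N. x\<^sub>0 ^ triangular (Suc v))"
    by (rule order_tendstoD) (use assms in simp)
  moreover have "\<forall>\<^sub>F N in sequentially. 1 \<le> N" by (rule eventually_ge_at_top)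
  ultimately obtain N where N: "1 - (x - x\<^sub>0) < (\<Sum>v<N. x\<^sub>0 ^ triangular (Suc v))" "1 \<le> N"
    by (metis (no_types, lifting) eventually_conj eventually_happens sequentially_bot)
  have "x - x\<^sub>0 = (\<Sum>v<1. x ^ triangular (Suc v) - x\<^sub>0 ^ triangular (Suc v))" by simp
  also have "\<dots> \<le> (\<Sum>v<N. x ^ triangular (Suc v) - x\<^sub>0 ^ triangular (Suc v))"
    using assms x N(2) by (intro sum_mono2) (auto simp del: triangular_simps intro!: power_mono)
  finally have "1 \<le> (\<Sum>v<N. x ^ triangular (Suc v))"
    using N(1) by (simp add: sum_subtractf del: triangular_simps)
  also have "\<dots> = (\<Sum>u=1..N. x ^ triangular u)"
    by (rule sum.reindex_bij_witness[of _ "\<lambda>u. u - 1" Suc]) auto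
  finally show ?thesis by blast
qed

section \<open>Limits of normalised logarithms\<close>

lemma lim_ereal_eln_geometric:
  assumes pos: "0 < c" "0 < b" "0 < r"
    and lower: "\<And>n. ennreal (c * r ^ n) \<le> a (Suc n)"
    and upper: "\<And>n. a (Suc n) \<le> ennreal (b * r ^ n)"
  shows "lim (\<lambda>n. ereal (1 / real n) * eln (a n)) = ereal (ln r)"
proof (rule limI)
  define T where "T n = enn2real (a (Suc n))" for n
  have fin: "a (Suc n) \<noteq> \<infinity>" for n
    using upper[of n] by (auto simp: top_unique)
  have T: "c * r ^ n \<le> T n" "T n \<le> b * r ^ n" for n
  proof -
    show "c * r ^ n \<le> T n"
      using enn2real_mono[OF lower[of n]] fin[of n] pos by (auto simp: T_def less_top)
    show "T n \<le> b * r ^ n"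
      using upper[of n] pos by (auto simp: T_def intro!: enn2real_leI)
  qed
  have Tpos: "0 < T n" for n
    using T(1)[of n] pos by (meson less_le_trans mult_pos_pos zero_less_power)
  have "eln (a (Suc n)) = ereal (ln (T n))" for n
    using fin[of n] Tpos[of n] by (auto simp: eln_def T_def)
  then have eq: "ereal (1 / real (Suc n)) * eln (a (Suc n)) = ereal (ln (T n) / real (Suc n))" for n
    by simp
  have aux: "(\<lambda>n. ln (k * r ^ n) / real (Suc n)) \<longlonglongrightarrow> ln r" if "0 < k" for k
  proof -
    have "(\<lambda>n. ln k * (1 / real (Suc n)) + ln r * (real n / real (Suc n))) \<longlonglongrightarrow> ln k * 0 + ln r * 1"
      using LIMSEQ_n_over_Suc_n[where 'a = real] LIMSEQ_Suc[OF lim_1_over_n[where 'a = real]]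
      by (intro tendsto_intros) auto
    then show ?thesis
      using that pos by (simp add: ln_mult ln_realpow add_divide_distrib mult.commute)
  qed
  have "(\<lambda>n. ln (T n) / real (Suc n)) \<longlonglongrightarrow> ln r"
  proof (rule tendsto_sandwich[OF _ _ aux[OF pos(1)] aux[OF pos(2)]])
    show "\<forall>\<^sub>F n in sequentially. ln (c * r ^ n) / real (Suc n) \<le> ln (T n) / real (Suc n)"
      using T(1) Tpos pos by (intro always_eventually allI divide_right_mono) auto
    show "\<forall>\<^sub>F n in sequentially. ln (T n) / real (Suc n) \<le> ln (b * r ^ n) / real (Suc n)"
      using T(2) Tpos pos by (intro always_eventually allI divide_right_mono) auto
  qed
  then have "(\<lambda>n. ereal (1 / real (Suc n)) * eln (a (Suc n))) \<longlonglongrightarrow> ereal (ln r)"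
    unfolding eq by simp
  then show "(\<lambda>n. ereal (1 / real n) * eln (a n)) \<longlonglongrightarrow> ereal (ln r)"
    by (rule LIMSEQ_imp_Suc)
qed

lemma lim_ereal_eln_top:
  assumes "\<And>n. a (Suc n) = \<infinity>"
  shows "lim (\<lambda>n. ereal (1 / real n) * eln (a n)) = \<infinity>"
proof (rule limI)
  have "ereal (1 / real (Suc n)) * eln (a (Suc n)) = \<infinity>" for n
    using assms[of n] by (simp add: eln_def)
  then have "(\<lambda>n. ereal (1 / real (Suc n)) * eln (a (Suc n))) \<longlonglongrightarrow> \<infinity>" by simp
  then show "(\<lambda>n. ereal (1 / real n) * eln (a n)) \<longlonglongrightarrow> \<infinity>"
    by (rule LIMSEQ_imp_Suc)
qed

section \<open>Similarities and packings of balls\<close>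

lemma similarity_affine:
  fixes f :: "real^'d \<Rightarrow> real^'d"
  assumes "similarity r f"
  obtains L where "linear L" "\<And>x. norm (L x) = r * norm x" "\<And>x. f x = f 0 + L x"
proof -
  have "linear (\<lambda>x. f x - f 0)"
    using assms by (intro scaling_linear[where c = r]) (auto simp: similarity_def dist_norm)
  then show ?thesis
    using assms by (intro that[of "\<lambda>x. f x - f 0"]) (auto simp: similarity_def dist_norm)
qed

lemma similarity_inj: "similarity r f \<Longrightarrow> inj f"
  by (auto simp: similarity_def inj_def) (metis dist_eq_0_iff mult_eq_0_iff less_irrefl)

lemma similarity_surj:
  fixes f :: "real^'d \<Rightarrow> real^'d"
  assumes "similarity r f"
  shows "surj f"
proof -
  obtain L where L: "linear L" "\<And>x. norm (L x) = r * norm x" "\<And>x. f x = f 0 + L x"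
    using similarity_affine[OF assms] by blast
  have "inj L"
    using L(2) assms unfolding linear_injective_0[OF L(1)]
    by (metis similarity_def mult_eq_0_iff norm_eq_zero less_irrefl)
  then have "surj L" using L(1) linear_injective_imp_surjective by blast
  then show ?thesis
    unfolding surj_def by (metis L(3) add_diff_cancel_left' diff_add_cancel add.commute)
qed

lemma similarity_image_ball:
  fixes f :: "real^'d \<Rightarrow> real^'d"
  assumes "similarity r f"
  shows "f ` ball a e = ball (f a) (r * e)" "f ` cball a e = cball (f a) (r * e)"
proof -
  have r: "0 < r" and f: "\<And>x y. dist (f x) (f y) = r * dist x y"
    using assms by (auto simp: similarity_def)
  have surj: "\<exists>x. y = f x" for y
    using similarity_surj[OF assms] by (auto simp: surj_def)
  show "f ` ball a e = ball (f a) (r * e)"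
  proof (intro equalityI subsetI)
    fix y assume "y \<in> ball (f a) (r * e)"
    then show "y \<in> f ` ball a e" using surj[of y] r by (auto simp: f)
  qed (use r in \<open>auto simp: f\<close>)
  show "f ` cball a e = cball (f a) (r * e)"
  proof (intro equalityI subsetI)
    fix y assume "y \<in> cball (f a) (r * e)"
    then show "y \<in> f ` cball a e" using surj[of y] r by (auto simp: f)
  qed (use r in \<open>auto simp: f\<close>)
qed

lemma onorm_scaling:
  fixes M :: "real^'n^'m"
  assumes "\<And>x. norm (M *v x) = r * norm x"
  shows "onorm (\<lambda>x. M *v x) = r"
proof (rule antisym)
  obtain e :: "real^'n" where e: "e \<noteq> 0" using zero_neq_one by metis
  have "0 \<le> r * norm e" using assms[of e] norm_ge_zero by metis
  then have "0 \<le> r" using e by (simp add: zero_le_mult_iff)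
  then show "onorm (\<lambda>x. M *v x) \<le> r" using assms by (intro onorm_bound) auto
  have "norm (M *v e) / norm e \<le> onorm (\<lambda>x. M *v x)"
    by (rule le_onorm) (rule matrix_vector_mul_bounded_linear)
  then show "r \<le> onorm (\<lambda>x. M *v x)" using assms[of e] e by simp
qed

lemma similarity_jacobian:
  fixes f :: "real^'d \<Rightarrow> real^'d"
  assumes "similarity r f"
  shows op_norm_jacobian_similarity: "op_norm (jacobian f (at x)) = r"
    and lower_norm_jacobian_similarity: "lower_norm (jacobian f (at x)) = r"
proof -
  obtain L where L: "linear L" "\<And>x. norm (L x) = r * norm x" "\<And>x. f x = f 0 + L x"
    using similarity_affine[OF assms] by blast
  have r: "0 < r" using assms by (simp add: similarity_def)
  have "f = (\<lambda>x. f 0 + L x)" using L(3) by blast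
  moreover have "((\<lambda>x. f 0 + L x) has_derivative L) (at x)"
    using L(1) by (auto intro!: derivative_eq_intros linear_imp_has_derivative)
  ultimately have "(f has_derivative L) (at x)" by simp
  then have M: "jacobian f (at x) = matrix L"
    by (simp add: jacobian_def frechet_derivative_at[symmetric])
  have matL: "matrix L *v z = L z" for z using L(1) by (simp add: matrix_works)
  show "op_norm (jacobian f (at x)) = r"
    unfolding M op_norm_def by (rule onorm_scaling) (simp add: matL L(2))
  have "\<forall>x. matrix L *v x = 0 \<longrightarrow> x = 0"
    unfolding matL using L(2) r by (metis mult_eq_0_iff norm_eq_zero less_irrefl norm_zero)
  then have "invertible (matrix L)"
    unfolding invertible_left_inverse matrix_left_invertible_ker .
  then have inv: "matrix L ** matrix_inv (matrix L) = mat 1"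
    unfolding invertible_def matrix_inv_def by (rule someI2_ex) simp
  have N: "norm (matrix_inv (matrix L) *v z) = (1 / r) * norm z" for z
  proof -
    have "L (matrix_inv (matrix L) *v z) = z"
      using matL[of "matrix_inv (matrix L) *v z"] by (simp add: matrix_vector_mul_assoc inv)
    then have "norm z = r * norm (matrix_inv (matrix L) *v z)" by (metis L(2))
    then show ?thesis using r by simp
  qed
  have "op_norm (matrix_inv (matrix L)) = 1 / r"
    unfolding op_norm_def by (rule onorm_scaling) (rule N)
  then show "lower_norm (jacobian f (at x)) = r"
    unfolding M lower_norm_def by simp
qed

text \<open>Comparison of volumes, after each ball has been shrunk to the common radius \<open>\<epsilon>\<close>.\<close>
lemma card_packed_balls_le:
  fixes a :: "'i \<Rightarrow> 'a::euclidean_space"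
  assumes disj: "\<And>i j. i \<in> I \<Longrightarrow> j \<in> I \<Longrightarrow> i \<noteq> j \<Longrightarrow> ball (a i) (e i) \<inter> ball (a j) (e j) = {}"
    and rad: "\<And>i. i \<in> I \<Longrightarrow> \<epsilon> \<le> e i" and \<epsilon>: "0 < \<epsilon>" and R: "0 \<le> R"
    and sub: "\<And>i. i \<in> I \<Longrightarrow> ball (a i) (e i) \<subseteq> cball z R"
  shows "finite I" "real (card I) \<le> (R / \<epsilon>) ^ DIM('a)"
proof -
  let ?D = "DIM('a)"
  have bound: "real (card F) \<le> (R / \<epsilon>) ^ ?D" if F: "finite F" "F \<subseteq> I" for F
  proof -
    let ?v = "unit_ball_vol (real ?D)"
    have small: "ball (a i) \<epsilon> \<subseteq> ball (a i) (e i)" if "i \<in> F" for i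
      using rad[of i] that F(2) by (intro subset_ball) auto
    have "real (card F) * (?v * \<epsilon> ^ ?D) = (\<Sum>i\<in>F. measure lborel (ball (a i) \<epsilon>))"
      using \<epsilon> by (simp add: content_ball)
    also have "\<dots> = measure lborel (\<Union>i\<in>F. ball (a i) \<epsilon>)"
    proof (rule measure_finite_Union[symmetric])
      show "disjoint_family_on (\<lambda>i. ball (a i) \<epsilon>) F"
        unfolding disjoint_family_on_def
      proof (intro ballI impI)
        fix i j assume "i \<in> F" "j \<in> F" "i \<noteq> j"
        then show "ball (a i) \<epsilon> \<inter> ball (a j) \<epsilon> = {}"
          using small[of i] small[of j] disj[of i j] F(2) by blast
      qed
    qed (use F emeasure_lborel_ball_finite in \<open>auto simp: less_top[symmetric]\<close>)
    also have "\<dots> \<le> measure lborel (cball z R)"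
    proof (rule measure_mono_fmeasurable)
      show "(\<Union>i\<in>F. ball (a i) \<epsilon>) \<subseteq> cball z R"
        using small sub F(2) by blast
    qed (use F emeasure_lborel_cball_finite in \<open>auto intro!: fmeasurableI\<close>)
    also have "\<dots> = ?v * R ^ ?D"
      using R by (simp add: content_cball)
    finally have "real (card F) * \<epsilon> ^ ?D \<le> R ^ ?D"
      using unit_ball_vol_pos[of "real ?D"] by (simp add: mult.left_commute)
    then show ?thesis
      using \<epsilon> by (simp add: power_divide pos_le_divide_eq)
  qed
  show fin: "finite I"
  proof (rule finite_if_finite_subsets_card_bdd[THEN conjunct1])
    show "card G \<le> nat \<lfloor>(R / \<epsilon>) ^ ?D\<rfloor>" if "G \<subseteq> I" "finite G" for G
      using bound[OF that(2,1)] by (rule le_nat_floor)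
  qed
  show "real (card I) \<le> (R / \<epsilon>) ^ DIM('a)"
    by (rule bound[OF fin order_refl])
qed

section \<open>Infinite paths and their initial walks\<close>

definition walk_path :: "(nat \<Rightarrow> nat) \<Rightarrow> bool" where
  "walk_path \<omega> \<longleftrightarrow> (\<forall>n. edge (\<omega> n) (\<omega> (Suc n)))"

definition initial :: "(nat \<Rightarrow> 'v) \<Rightarrow> nat \<Rightarrow> 'v list" where
  "initial \<omega> n = map \<omega> [0..<Suc n]"

lemma initial_0: "initial \<omega> 0 = [\<omega> 0]"
  by (simp add: initial_def)

lemma initial_Suc: "initial \<omega> (Suc n) = \<omega> 0 # initial (shift \<omega>) n"
  unfolding initial_def shift_def by (subst map_upt_Suc) simp

lemma initial_snoc: "initial \<omega> (Suc n) = initial \<omega> n @ [\<omega> (Suc n)]"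
  by (simp add: initial_def)

lemma length_initial [simp]: "length (initial \<omega> n) = Suc n"
  by (simp add: initial_def)

lemma walk_path_shift: "walk_path \<omega> \<Longrightarrow> walk_path (shift \<omega>)"
  by (simp add: walk_path_def shift_def)

lemma is_walk_initial: "walk_path \<omega> \<Longrightarrow> is_walk (initial \<omega> n)"
proof (induction n arbitrary: \<omega>)
  case 0
  then show ?case using edge_ge_1 by (auto simp: initial_0 walk_path_def)
next
  case (Suc n)
  have "is_walk (initial (shift \<omega>) n)" "edge (\<omega> 0) (shift \<omega> 0)"
    using Suc walk_path_shift by (auto simp: walk_path_def shift_def)
  then show ?case by (cases n) (auto simp: initial_Suc initial_0)
qed

text \<open>From any vertex one can descend to \<open>1\<close> and then stay there, since \<open>1\<close> carries a loop.\<close>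
lemma ex_walk_path: "is_walk w \<Longrightarrow> \<exists>\<omega>. walk_path \<omega> \<and> initial \<omega> (length w - 1) = w"
proof (induction w rule: induct_list012)
  case (2 v)
  have "walk_path (\<lambda>n. max 1 (v - n))"
    using 2 by (auto simp: walk_path_def edge_def max_def)
  with 2 show ?case by (intro exI[of _ "\<lambda>n. max 1 (v - n)"]) (auto simp: initial_0)
next
  case (3 v u ws)
  then obtain \<omega> where \<omega>: "walk_path \<omega>" "initial \<omega> (length ws) = u # ws" by auto
  have "\<omega> 0 = u" using \<omega>(2) by (cases "length ws") (auto simp: initial_0 initial_Suc)
  then have "walk_path (case_nat v \<omega>)"
    using \<omega>(1) 3 by (auto simp: walk_path_def split: nat.split)
  moreover have "shift (case_nat v \<omega>) = \<omega>" by (simp add: shift_def)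
  ultimately show ?case
    using \<omega>(2) by (intro exI[of _ "case_nat v \<omega>"]) (auto simp: initial_Suc)
qed simp

lemma funpow_shift: "(shift ^^ i) \<omega> = (\<lambda>n. \<omega> (n + i))"
  by (induction i arbitrary: \<omega>) (auto simp: shift_def)

lemma path_map_Suc_shift:
  "path_map S \<omega> (Suc k) = emap S (\<omega> 0) (\<omega> 1) \<circ> path_map S (shift \<omega>) k"
  by (induction k) (auto simp: shift_def fun_eq_iff)

text \<open>The radius of the ball \<open>J\<^sub>v\<close> of the last vertex, contracted along all the preceding edges.\<close>
definition radius :: "nat list \<Rightarrow> real" where
  "radius w = (1 / 2) ^ sum_list w"

lemma radius_pos: "0 < radius w" by (simp add: radius_def)

lemma sum_list_initial_ge: "walk_path \<omega> \<Longrightarrow> Suc n \<le> sum_list (initial \<omega> n)"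
proof (induction n)
  case 0
  then show ?case using edge_ge_1 by (auto simp: initial_0 walk_path_def)
next
  case (Suc n)
  then have "1 \<le> \<omega> (Suc n)" using edge_ge_1 by (auto simp: walk_path_def)
  with Suc show ?case by (simp add: initial_snoc)
qed

lemma radius_initial_le: "walk_path \<omega> \<Longrightarrow> radius (initial \<omega> n) \<le> (1 / 2) ^ Suc n"
  unfolding radius_def using sum_list_initial_ge by (intro power_decreasing) auto

text \<open>The centre of the ball of the last vertex, mapped along the walk; the value for the empty list is
  a dummy.\<close>
fun centre :: "(nat, real^'d) graph_system \<Rightarrow> (nat \<Rightarrow> real^'d) \<Rightarrow> nat list \<Rightarrow> real^'d" where
  "centre S c [] = 0"
| "centre S c [v] = c v"
| "centre S c (v # u # ws) = emap S v u (centre S c (u # ws))"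

lemma radius_powr: "radius w powr t = (2 powr - t) ^ sum_list w"
proof -
  have "radius w = 2 powr - real (sum_list w)"
    by (simp add: radius_def powr_minus powr_realpow power_one_over inverse_eq_divide)
  then show ?thesis by (simp add: powr_powr powr_power mult.commute)
qed

section \<open>Masses of walks and stopping walks\<close>

text \<open>If a mass on the nodes of a tree is at most the total mass of the children, then a set of nodes with
  less mass than the root cannot block all branches. Keep the invariant that the members of \<open>W\<close>
  below the current node weigh less than this node: it excludes the node itself from \<open>W\<close>, and if it
  failed at all children, summing over them would contradict it at the node.\<close>
lemma ex_branch_avoiding:
  fixes m :: "'a::countable list \<Rightarrow> ennreal"
  assumes succ: "\<And>a. P a \<Longrightarrow> finite (succ a)"
    and sub: "\<And>a. P a \<Longrightarrow> m a \<le> (\<Sum>u\<in>succ a. m (a @ [u]))"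
    and P: "\<And>a u. P a \<Longrightarrow> u \<in> succ a \<Longrightarrow> P (a @ [u])"
    and start: "P a" "infsum m {w \<in> W. prefix a w} < m a"
  shows "\<exists>f. f 0 = a \<and> (\<forall>n. f n \<notin> W \<and> P (f n) \<and> (\<exists>u\<in>succ (f n). f (Suc n) = f n @ [u]))"
proof -
  define Q where "Q b \<longleftrightarrow> P b \<and> infsum m {w \<in> W. prefix b w} < m b" for b
  have notin: "b \<notin> W" if "Q b" for b
  proof
    assume "b \<in> W"
    then have "infsum m {b} \<le> infsum m {w \<in> W. prefix b w}"
      by (intro infsum_ennreal_subset) auto
    with that show False by (auto simp: Q_def dest: leD)
  qed
  have step: "\<exists>b'. Q b' \<and> (\<exists>u\<in>succ b. b' = b @ [u])" if "Q b" for b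
  proof (rule ccontr)
    assume neg: "\<not> ?thesis"
    let ?D = "\<lambda>u. {w \<in> W. prefix (b @ [u]) w}"
    have "m b \<le> (\<Sum>u\<in>succ b. m (b @ [u]))" using that sub by (simp add: Q_def)
    also have "\<dots> \<le> (\<Sum>u\<in>succ b. infsum m (?D u))"
      using neg that P by (intro sum_mono) (auto simp: Q_def not_less)
    also have "\<dots> = infsum m (\<Union>u\<in>succ b. ?D u)"
      unfolding infsum_ennreal_eq_emeasure using that succ
      by (intro sum_emeasure) (auto simp: Q_def disjoint_family_on_def prefix_def)
    also have "\<dots> \<le> infsum m {w \<in> W. prefix b w}"
      by (intro infsum_ennreal_subset) (auto dest: append_prefixD)
    finally show False using that by (auto simp: Q_def dest: leD)
  qed
  have "\<exists>f. \<forall>n. (Q (f n) \<and> (n = 0 \<longrightarrow> f n = a)) \<and> (\<exists>u\<in>succ (f n). f (Suc n) = f n @ [u])"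
  proof (rule dependent_nat_choice)
    show "\<exists>b. Q b \<and> (0 = 0 \<longrightarrow> b = a)" using start by (auto simp: Q_def)
    show "\<exists>b'. (Q b' \<and> (Suc n = 0 \<longrightarrow> b' = a)) \<and> (\<exists>u\<in>succ b. b' = b @ [u])"
      if "Q b \<and> (n = 0 \<longrightarrow> b = a)" for b n
      using step[of b] that by blast
  qed
  then obtain f where
    f: "\<forall>n. (Q (f n) \<and> (n = 0 \<longrightarrow> f n = a)) \<and> (\<exists>u\<in>succ (f n). f (Suc n) = f n @ [u])" ..
  then have "f n \<notin> W" for n using notin by blast
  with f show ?thesis by (intro exI[of _ f]) (simp add: Q_def)
qed

text \<open>Up to the last vertex the edges carry the weights \<open>x ^ v\<close>, and the last vertex carries the
  value of the eigenvector \<open>h\<close> for \<open>y = 1\<close>.\<close>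
definition mass :: "real \<Rightarrow> nat list \<Rightarrow> ennreal" where
  "mass x w = ennreal (x ^ (sum_list (butlast w) + triangular (last w)))"

lemma sum_list_butlast: "a \<noteq> [] \<Longrightarrow> sum_list a = sum_list (butlast a) + last (a :: nat list)"
  by (induction a rule: rev_induct) auto

text \<open>Above \<open>1\<close> there is only one child, with the same mass. At the vertex \<open>1\<close> the assumption on
  \<open>N\<close> is exactly what is needed.\<close>
lemma mass_le_sum_children:
  assumes x: "0 < x" and N: "1 \<le> (\<Sum>u=1..N. x ^ triangular u)"
    and a: "is_walk a" "set a \<subseteq> {..N}"
  shows "mass x a \<le> (\<Sum>u | u \<le> N \<and> edge (last a) u. mass x (a @ [u]))"
proof -
  have ne: "a \<noteq> []" using a by auto
  then have last: "1 \<le> last a" "last a \<le> N"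
    using a is_walk_set[of a "last a"] subsetD[OF a(2) last_in_set[OF ne]] ne by auto
  have child: "mass x (a @ [u]) = ennreal (x ^ (sum_list (butlast a) + last a) * x ^ triangular u)" for u
    using ne by (simp add: mass_def sum_list_butlast[of a] flip: power_add)
  show ?thesis
  proof (cases "last a = 1")
    case True
    then have "{u. u \<le> N \<and> edge (last a) u} = {1..N}" by (auto simp: edge_def)
    then have "(\<Sum>u | u \<le> N \<and> edge (last a) u. mass x (a @ [u]))
        = ennreal (x ^ (sum_list (butlast a) + 1) * (\<Sum>u=1..N. x ^ triangular u))"
      using x True by (simp add: child sum_distrib_left)
    moreover have "x ^ (sum_list (butlast a) + 1) * 1 \<le> x ^ (sum_list (butlast a) + 1) * (\<Sum>u=1..N. x ^ triangular u)"
      using x N by (intro mult_left_mono) auto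
    ultimately show ?thesis using True by (auto simp: mass_def numeral_eq_Suc intro!: ennreal_leI)
  next
    case False
    then obtain v where v: "last a = Suc v" "1 \<le> v" using last by (cases "last a") auto
    then have "{u. u \<le> N \<and> edge (last a) u} = {v}" using last by (auto simp: edge_def)
    then show ?thesis by (simp only: child) (simp add: v mass_def power_add mult_ac)
  qed
qed

text \<open>In the tree of walks from \<open>1\<close> through the vertices up to \<open>N\<close> a branch is an infinite path, and one
  that avoids \<open>W\<close> would contradict the covering assumption.\<close>
lemma mass_cover_ge:
  assumes x: "0 < x" and N: "1 \<le> (\<Sum>u=1..N. x ^ triangular u)"
    and cover: "\<And>\<omega>. walk_path \<omega> \<Longrightarrow> \<omega> 0 = 1 \<Longrightarrow> (\<And>n. \<omega> n \<le> N) \<Longrightarrow> \<exists>n. initial \<omega> n \<in> W"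
  shows "ennreal x \<le> infsum (mass x) W"
proof (rule ccontr)
  assume neg: "\<not> ?thesis"
  have N1: "1 \<le> N" using N by (cases N) auto
  have m1: "mass x [1] = ennreal x" by (simp add: mass_def)
  have "infsum (mass x) {w \<in> W. prefix [1] w} \<le> infsum (mass x) W"
    by (intro infsum_ennreal_subset) auto
  also have "\<dots> < mass x [1]" using neg m1 by simp
  finally have small: "infsum (mass x) {w \<in> W. prefix [1] w} < mass x [1]" .
  have "\<exists>f. f 0 = [1] \<and> (\<forall>n. f n \<notin> W \<and> (is_walk (f n) \<and> set (f n) \<subseteq> {..N}) \<and>
      (\<exists>u\<in>{u. u \<le> N \<and> edge (last (f n)) u}. f (Suc n) = f n @ [u]))"
    by (rule ex_branch_avoiding[where m = "mass x" and P = "\<lambda>a. is_walk a \<and> set a \<subseteq> {..N}"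
          and succ = "\<lambda>a. {u. u \<le> N \<and> edge (last a) u}"])
      (use small N1 mass_le_sum_children[OF x N] is_walk_snoc in auto)
  then obtain f where f: "f 0 = [1]" "\<And>n. f n \<notin> W" "\<And>n. is_walk (f n)" "\<And>n. set (f n) \<subseteq> {..N}"
    "\<And>n. \<exists>u. edge (last (f n)) u \<and> f (Suc n) = f n @ [u]" by blast
  define \<omega> where "\<omega> n = last (f n)" for n
  have eq: "initial \<omega> n = f n" for n
  proof (induction n)
    case 0
    then show ?case using f(1) by (simp add: initial_0 \<omega>_def)
  next
    case (Suc n)
    then show ?case using f(5)[of n] by (auto simp: initial_snoc \<omega>_def)
  qed
  have "walk_path \<omega>" unfolding walk_path_def
  proof
    fix n show "edge (\<omega> n) (\<omega> (Suc n))" using f(5)[of n] by (auto simp: \<omega>_def)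
  qed
  moreover have "\<omega> 0 = 1" using f(1) by (simp add: \<omega>_def)
  moreover have "\<omega> n \<le> N" for n
  proof -
    have "f n \<noteq> []" using f(3)[of n] by auto
    then show ?thesis using f(4)[of n] last_in_set by (auto simp: \<omega>_def)
  qed
  ultimately show False using cover[of \<omega>] f(2) eq by auto
qed

text \<open>Each walk is cut as soon as its radius is at most \<open>d\<close>, so that the radii are comparable to \<open>d\<close>
  as long as the vertices are bounded, and no stopping walk extends another one.\<close>
definition stopping_walks :: "nat \<Rightarrow> real \<Rightarrow> nat list set" where
  "stopping_walks N d = {w. is_walk w \<and> set w \<subseteq> {..N} \<and> radius w \<le> d \<and>
     (\<forall>k. 0 < k \<and> k < length w \<longrightarrow> d < radius (take k w))}"

lemma ex_initial_stopping:
  assumes "walk_path \<omega>" "\<And>n. \<omega> n \<le> N" "0 < d"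
  shows "\<exists>n. initial \<omega> n \<in> stopping_walks N d"
proof -
  have "radius (initial \<omega> n) \<le> (1 / 2) ^ n" for n
    by (rule order_trans[OF radius_initial_le[OF assms(1)]]) (intro power_decreasing; simp)
  moreover obtain n where "(1 / 2) ^ n < d"
    using real_arch_pow_inv[of d "1 / 2"] assms by auto
  ultimately have ex: "\<exists>n. radius (initial \<omega> n) \<le> d" by (meson less_imp_le order_trans)
  define n where "n = (LEAST n. radius (initial \<omega> n) \<le> d)"
  have n: "radius (initial \<omega> n) \<le> d" using LeastI_ex[OF ex] by (simp add: n_def)
  have "d < radius (take k (initial \<omega> n))" if k: "0 < k" "k < Suc n" for k
  proof -
    have "take k (initial \<omega> n) = initial \<omega> (k - 1)"
      using k by (simp add: initial_def take_map del: upt_Suc)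
    moreover have "\<not> radius (initial \<omega> (k - 1)) \<le> d"
      using k not_less_Least[of "k - 1" "\<lambda>n. radius (initial \<omega> n) \<le> d"] by (simp add: n_def[symmetric])
    ultimately show ?thesis by simp
  qed
  moreover have "set (initial \<omega> n) \<subseteq> {..N}" using assms(2) by (auto simp: initial_def)
  ultimately show ?thesis
    using n is_walk_initial[OF assms(1)] by (auto simp: stopping_walks_def)
qed

text \<open>The last vertex costs a factor of at least \<open>(1 / 2) ^ N\<close>, and before it the radius was still at least
  \<open>d\<close>. For walks with only one vertex this needs \<open>d \<le> 1\<close>.\<close>
lemma stopping_walks_radius_ge:
  assumes w: "w \<in> stopping_walks N d" and d: "d \<le> 1"
  shows "(1 / 2) ^ N * d \<le> radius w"
proof -
  have ne: "w \<noteq> []" using w by (auto simp: stopping_walks_def)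
  then have eq: "radius w = (1 / 2) ^ last w * radius (butlast w)"
    by (simp add: radius_def sum_list_butlast power_add)
  have "last w \<le> N" using w ne last_in_set by (auto simp: stopping_walks_def)
  then have "(1 / 2 :: real) ^ N \<le> (1 / 2) ^ last w" by (intro power_decreasing) auto
  moreover have "d \<le> radius (butlast w)"
  proof (cases "butlast w = []")
    case True
    then show ?thesis using d by (simp add: radius_def)
  next
    case False
    then have "0 < length w - 1" by (cases w) auto
    then show ?thesis using w by (auto simp: stopping_walks_def butlast_conv_take intro: less_imp_le)
  qed
  ultimately show ?thesis unfolding eq using radius_pos[of "butlast w"]
    by (cases "0 \<le> d") (auto intro: mult_mono order_trans[of _ 0] simp: mult_nonneg_nonpos)
qed

lemma stopping_walks_prefix_free:
  assumes "w \<in> stopping_walks N d" "w' \<in> stopping_walks N d" "prefix w w'"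
  shows "w = w'"
proof (rule ccontr)
  assume "w \<noteq> w'"
  with assms(3) have "length w < length w'" "take (length w) w' = w"
    by (auto simp: prefix_def)
  moreover have "w \<noteq> []" using assms(1) by (auto simp: stopping_walks_def)
  ultimately show False using assms by (force simp: stopping_walks_def)
qed

section \<open>Coverings and Hausdorff measure\<close>

text \<open>Covers in the definition of the Hausdorff measure are sequences; an arbitrary countable family becomes
  one when the unused indices are filled with empty sets.\<close>
lemma hausdorff_premeasure_le_infsum:
  fixes C :: "'i::countable \<Rightarrow> 'a::metric_space set"
  assumes "A \<subseteq> (\<Union>i\<in>I. C i)" "\<And>i. i \<in> I \<Longrightarrow> bounded (C i)" "\<And>i. i \<in> I \<Longrightarrow> diameter (C i) \<le> \<delta>" "0 \<le> \<delta>"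
  shows "(INF U\<in>delta_covers \<delta> A. \<Sum>\<^sub>\<infinity>i\<in>UNIV. diam_pow s (U i)) \<le> (\<Sum>\<^sub>\<infinity>i\<in>I. diam_pow s (C i))"
proof -
  define U where "U n = (if n \<in> to_nat ` I then C (from_nat n) else {})" for n
  have "U \<in> delta_covers \<delta> A"
    using assms by (fastforce simp: delta_covers_def U_def)
  then have "(INF U\<in>delta_covers \<delta> A. \<Sum>\<^sub>\<infinity>i\<in>UNIV. diam_pow s (U i)) \<le> (\<Sum>\<^sub>\<infinity>i\<in>UNIV. diam_pow s (U i))"
    by (rule INF_lower)
  also have "\<dots> = (\<Sum>\<^sub>\<infinity>i\<in>to_nat ` I. diam_pow s (U i))"
    by (intro infsum_cong_neutral) (auto simp: U_def diam_pow_def)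
  also have "\<dots> = (\<Sum>\<^sub>\<infinity>i\<in>I. diam_pow s (C i))"
    by (subst infsum_reindex) (auto simp: U_def o_def intro!: infsum_cong)
  finally show ?thesis .
qed

text \<open>The stopping walks need a positive scale. Sets of diameter \<open>0\<close> are therefore assigned a small
  positive one at the cost of \<open>e\<close>; for \<open>t = 0\<close>, where every nonempty set contributes \<open>1\<close>,
  the scale \<open>1\<close> does.\<close>
lemma ex_scale:
  assumes "0 \<le> t" "U \<noteq> {}" "bounded U" "diameter U \<le> 1" "0 < e"
  shows "\<exists>d. 0 < d \<and> d \<le> 1 \<and> diameter U \<le> d \<and> ennreal (d powr t) \<le> diam_pow t U + ennreal e"
proof (cases "t = 0")
  case True
  with assms show ?thesis by (intro exI[of _ 1]) (auto simp: diam_pow_def)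
next
  case t: False
  show ?thesis
  proof (cases "diameter U = 0")
    case True
    define d where "d = min 1 (e powr (1 / t))"
    have "d powr t \<le> (e powr (1 / t)) powr t"
      using assms by (intro powr_mono2) (auto simp: d_def)
    also have "\<dots> = e" using assms t by (simp add: powr_powr)
    finally have "ennreal (d powr t) \<le> diam_pow t U + ennreal e"
      by (intro add_increasing ennreal_leI) auto
    with True assms show ?thesis by (intro exI[of _ d]) (auto simp: d_def)
  next
    case False
    then have "0 < diameter U" using diameter_ge_0[OF assms(3)] by simp
    with assms t show ?thesis by (intro exI[of _ "diameter U"]) (auto simp: diam_pow_def)
  qed
qed

section \<open>Cells and coding of the system\<close>

locale descending_system =
  fixes S :: "(nat, real^'d) graph_system"
    and c :: "nat \<Rightarrow> real^'d"
  assumes vertices: "vertices S = {v. 1 \<le> v}"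
    and edges: "edges S = {(v, u). v = 1 \<and> 1 \<le> u} \<union> {(v, u). 2 \<le> v \<and> u = v - 1}"
    and seed: "\<And>v. v \<in> vertices S \<Longrightarrow> seed S v = cball (c v) (1 / 2 ^ v)"
    and centres: "\<And>v v'. v \<in> vertices S \<Longrightarrow> v' \<in> vertices S \<Longrightarrow> v \<noteq> v' \<Longrightarrow>
        interior (seed S v) \<inter> interior (seed S v') = {}"
    and similarity: "\<And>v u. (v, u) \<in> edges S \<Longrightarrow> similarity ((1 / 2) ^ v) (emap S v u)"
    and into: "\<And>v u. (v, u) \<in> edges S \<Longrightarrow> emap S v u ` seed S u \<subseteq> seed S v"
    and open_set_condition: "\<And>v u v' u'. (v, u) \<in> edges S \<Longrightarrow> (v', u') \<in> edges S \<Longrightarrow>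
        (v, u) \<noteq> (v', u') \<Longrightarrow>
        emap S v u ` interior (seed S u) \<inter> emap S v' u' ` interior (seed S u') = {}"
begin

definition cell :: "nat list \<Rightarrow> (real^'d) set" where
  "cell w = cball (centre S c w) (radius w)"

definition open_cell :: "nat list \<Rightarrow> (real^'d) set" where
  "open_cell w = ball (centre S c w) (radius w)"

lemma edges_iff: "(v, u) \<in> edges S \<longleftrightarrow> edge v u"
  by (auto simp: edges edge_def)

lemma path_space_eq: "path_space S = {\<omega>. walk_path \<omega>}"
  using edge_ge_1 by (auto simp: path_space_def walk_path_def edges_iff vertices)

lemma cell_singleton: "1 \<le> v \<Longrightarrow> cell [v] = seed S v"
  by (simp add: cell_def radius_def seed vertices power_one_over)

lemma cell_Cons: "edge v u \<Longrightarrow> cell (v # u # ws) = emap S v u ` cell (u # ws)"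
  using similarity[unfolded edges_iff, of v u]
  by (simp add: cell_def radius_def similarity_image_ball power_add)

lemma open_cell_Cons: "edge v u \<Longrightarrow> open_cell (v # u # ws) = emap S v u ` open_cell (u # ws)"
  using similarity[unfolded edges_iff, of v u]
  by (simp add: open_cell_def radius_def similarity_image_ball power_add)

lemma cell_subset_seed: "is_walk (v # ws) \<Longrightarrow> cell (v # ws) \<subseteq> seed S v"
proof (induction ws arbitrary: v)
  case (Cons u ws)
  then show ?case using into[unfolded edges_iff, of v u] cell_Cons[of v u ws] by fastforce
qed (simp add: cell_singleton)

lemma open_cell_subset_seed: "is_walk (v # ws) \<Longrightarrow> open_cell (v # ws) \<subseteq> interior (seed S v)"
  using cell_subset_seed[of v ws] interior_mono[of "cell (v # ws)"]
  by (simp add: open_cell_def cell_def)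

text \<open>Two walks of which neither extends the other differ at some first place. If they differ at the start,
  the seeds separate them; otherwise two distinct edges out of the same vertex do, by the open
  set condition, and the common initial piece acts injectively.\<close>
lemma open_cells_disjoint:
  "is_walk w \<Longrightarrow> is_walk w' \<Longrightarrow> \<not> prefix w w' \<Longrightarrow> \<not> prefix w' w \<Longrightarrow>
    open_cell w \<inter> open_cell w' = {}"
proof (induction w arbitrary: w')
  case (Cons v ws)
  obtain v' ws' where w': "w' = v' # ws'" using Cons.prems by (cases w') auto
  show ?case
  proof (cases "v = v'")
    case False
    then show ?thesis
      using Cons.prems open_cell_subset_seed[of v ws] open_cell_subset_seed[of v' ws'] centres[of v v']
        is_walk_set[of "v # ws" v] is_walk_set[of w' v']
      by (auto simp: w' vertices)
  next
    case True
    obtain u us where ws: "ws = u # us" using Cons.prems True w' by (cases ws) auto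
    obtain u' us' where ws': "ws' = u' # us'" using Cons.prems True w' by (cases ws') auto
    have e: "edge v u" "edge v u'" using Cons.prems by (auto simp: w' ws ws' True)
    show ?thesis
    proof (cases "u = u'")
      case False
      then show ?thesis
        using e Cons.prems open_set_condition[unfolded edges_iff, of v u v u']
          open_cell_subset_seed[of u us] open_cell_subset_seed[of u' us']
        by (auto simp: w' ws ws' True open_cell_Cons)
    next
      case uu: True
      have "open_cell (u # us) \<inter> open_cell (u' # us') = {}"
        using Cons.prems Cons.IH[of "u' # us'"] by (auto simp: w' ws ws' True)
      moreover have "inj (emap S v u)"
        using similarity_inj similarity[unfolded edges_iff, OF e(1)] by blast
      ultimately show ?thesis
        using e by (simp add: w' ws ws' True[symmetric] uu[symmetric] open_cell_Cons flip: image_Int)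
    qed
  qed
qed simp

lemma path_map_image_seed:
  "walk_path \<omega> \<Longrightarrow> path_map S \<omega> k ` seed S (\<omega> (Suc k)) = cell (initial \<omega> (Suc k))"
proof (induction k arbitrary: \<omega>)
  case 0
  have "edge (\<omega> 0) (\<omega> 1)" using 0 by (auto simp: walk_path_def)
  then show ?case
    using edge_ge_1 by (auto simp: initial_Suc initial_0 cell_Cons cell_singleton shift_def)
next
  case (Suc k)
  have "edge (\<omega> 0) (\<omega> 1)" using Suc by (auto simp: walk_path_def)
  then have "cell (initial \<omega> (Suc (Suc k))) = emap S (\<omega> 0) (\<omega> 1) ` cell (initial (shift \<omega>) (Suc k))"
    by (simp add: initial_Suc cell_Cons shift_def)
  also have "\<dots> = path_map S \<omega> (Suc k) ` seed S (shift \<omega> (Suc k))"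
    unfolding path_map_Suc_shift image_comp[symmetric]
    using Suc.IH[OF walk_path_shift[OF Suc.prems]] by simp
  finally show ?case by (simp add: shift_def del: path_map.simps)
qed

lemma cell_initial_Suc_subset: "walk_path \<omega> \<Longrightarrow> cell (initial \<omega> (Suc n)) \<subseteq> cell (initial \<omega> n)"
proof (induction n arbitrary: \<omega>)
  case 0
  then have "edge (\<omega> 0) (\<omega> 1)" by (auto simp: walk_path_def)
  then show ?case
    using is_walk_initial[OF 0, of 1] cell_subset_seed[of "\<omega> 0" "[\<omega> 1]"] edge_ge_1
    by (auto simp: initial_Suc initial_0 cell_singleton shift_def)
next
  case (Suc n)
  have "edge (\<omega> 0) (\<omega> 1)" using Suc by (auto simp: walk_path_def)
  moreover have "initial (shift \<omega>) n = \<omega> 1 # tl (initial (shift \<omega>) n)"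
    by (cases n) (auto simp: initial_Suc initial_0 shift_def)
  moreover have "initial (shift \<omega>) (Suc n) = \<omega> 1 # tl (initial (shift \<omega>) (Suc n))"
    by (auto simp: initial_Suc initial_0 shift_def)
  ultimately have "cell (initial \<omega> (Suc m)) = emap S (\<omega> 0) (\<omega> 1) ` cell (initial (shift \<omega>) m)"
    if "m \<in> {n, Suc n}" for m
    using that unfolding initial_Suc[of \<omega>] by (metis cell_Cons insertE singletonD)
  then show ?case
    using Suc.IH[OF walk_path_shift[OF Suc.prems]] by (simp add: image_mono)
qed

text \<open>The cells of the initial walks of a path are nested compact balls whose radii tend to \<open>0\<close>, so the
  intersection that defines the coding map is a single point.\<close>
lemma coding_map_in_cell:
  assumes "walk_path \<omega>"
  shows "coding_map S \<omega> \<in> cell (initial \<omega> n)"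
proof -
  let ?A = "\<lambda>k. cell (initial \<omega> (Suc k))"
  have dec: "?A n \<subseteq> ?A m" if "m \<le> n" for m n
    using that by (induction rule: dec_induct) (use cell_initial_Suc_subset[OF assms] in auto)
  have "\<exists>a. \<Inter> (range ?A) = {a}"
  proof (rule decreasing_closed_nest_sing)
    fix e :: real assume "0 < e"
    then obtain n where n: "(1 / 2) ^ n < e / 2"
      using real_arch_pow_inv[of "e / 2" "1 / 2"] by auto
    have "dist x y < e" if "x \<in> ?A n" "y \<in> ?A n" for x y
    proof -
      have "dist x y \<le> 2 * radius (initial \<omega> (Suc n))"
        using that dist_triangle2[of x y "centre S c (initial \<omega> (Suc n))"]
        by (auto simp: cell_def dist_commute)
      also have "\<dots> \<le> 2 * (1 / 2) ^ n"
        using radius_initial_le[OF assms, of "Suc n"] radius_pos[of "initial \<omega> (Suc n)"]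
        by simp
      finally show ?thesis using n by simp
    qed
    then show "\<exists>n. \<forall>x\<in>?A n. \<forall>y\<in>?A n. dist x y < e" by blast
  qed (use dec in \<open>auto simp: cell_def less_imp_le[OF radius_pos] not_less\<close>)
  then obtain a where a: "\<Inter> (range ?A) = {a}" by blast
  then have "coding_map S \<omega> = a"
    unfolding coding_map_def path_map_image_seed[OF assms] by (auto intro: the_equality)
  then have "coding_map S \<omega> \<in> cell (initial \<omega> (Suc n))" using a by blast
  then show ?thesis using cell_initial_Suc_subset[OF assms] by blast
qed

lemma vertex_potential_eq:
  assumes "walk_path \<omega>"
  shows "vertex_potential S \<omega> = - real (\<omega> 0) * ln 2"
proof -
  have "similarity ((1 / 2) ^ \<omega> 0) (emap S (\<omega> 0) (\<omega> 1))"
    using assms by (intro similarity) (auto simp: edges_iff walk_path_def)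
  then show ?thesis
    by (simp add: vertex_potential_def op_norm_jacobian_similarity ln_realpow ln_div power_one_over)
qed

lemma cylinder_eq: "w \<noteq> [] \<Longrightarrow> cylinder S w = {\<omega>. walk_path \<omega> \<and> initial \<omega> (length w - 1) = w}"
  by (auto simp: cylinder_def path_space_eq initial_def simp del: upt_Suc)

lemma birkhoff_sum_vertex_potential:
  assumes "walk_path \<omega>"
  shows "(\<Sum>i<Suc n. t * vertex_potential S ((shift ^^ i) \<omega>)) = - t * ln 2 * real (sum_list (initial \<omega> n))"
proof (induction n)
  case (Suc n)
  have "walk_path ((shift ^^ Suc n) \<omega>)" using assms by (simp add: funpow_shift walk_path_def del: funpow.simps)
  then have "vertex_potential S ((shift ^^ Suc n) \<omega>) = - real (\<omega> (Suc n)) * ln 2"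
    by (simp add: vertex_potential_eq funpow_shift del: funpow.simps)
  with Suc show ?case by (simp add: initial_snoc algebra_simps del: funpow.simps)
qed (use assms in \<open>simp add: vertex_potential_eq initial_0\<close>)

text \<open>The potential depends on the first vertex only, so its Birkhoff sums are constant on cylinders.\<close>
lemma partition_sum_eq:
  "partition_sum S (\<lambda>\<omega>. t * vertex_potential S \<omega>) (Suc n) = total_sum (2 powr - t) n"
proof -
  have index: "{w. length w = Suc n \<and> set w \<subseteq> vertices S \<and> cylinder S w \<noteq> {}} = walks n"
  proof (intro equalityI subsetI)
    fix w assume w: "w \<in> {w. length w = Suc n \<and> set w \<subseteq> vertices S \<and> cylinder S w \<noteq> {}}"
    then obtain \<omega> where "walk_path \<omega>" "initial \<omega> n = w" by (cases "w = []") (auto simp: cylinder_eq)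
    then show "w \<in> walks n" using w is_walk_initial by (auto simp: walks_def)
  next
    fix w assume "w \<in> walks n"
    moreover from this obtain \<omega> where "walk_path \<omega>" "initial \<omega> n = w"
      using ex_walk_path[of w] by (auto simp: walks_def)
    ultimately show "w \<in> {w. length w = Suc n \<and> set w \<subseteq> vertices S \<and> cylinder S w \<noteq> {}}"
      using is_walk_set by (cases "w = []") (auto simp: walks_def vertices cylinder_eq)
  qed
  have "eexp (SUP \<omega>\<in>cylinder S w. ereal (\<Sum>i<Suc n. t * vertex_potential S ((shift ^^ i) \<omega>)))
      = ennreal ((2 powr - t) ^ sum_list w)" if "w \<in> walks n" for w
  proof -
    have w: "w \<noteq> []" "length w = Suc n" using that by (auto simp: walks_def)
    have ne: "cylinder S w \<noteq> {}" using that index by blast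
    have "(SUP \<omega>\<in>cylinder S w. ereal (\<Sum>i<Suc n. t * vertex_potential S ((shift ^^ i) \<omega>)))
        = (SUP \<omega>\<in>cylinder S w. ereal (- t * ln 2 * real (sum_list w)))"
    proof (rule SUP_cong[OF refl])
      fix \<omega> assume "\<omega> \<in> cylinder S w"
      then have "walk_path \<omega>" "initial \<omega> n = w" using w by (auto simp: cylinder_eq)
      then show "ereal (\<Sum>i<Suc n. t * vertex_potential S ((shift ^^ i) \<omega>)) = ereal (- t * ln 2 * real (sum_list w))"
        using birkhoff_sum_vertex_potential[of \<omega> t n] by simp
    qed
    also have "\<dots> = ereal (- t * ln 2 * real (sum_list w))" using ne by simp
    finally show ?thesis
      by (simp add: eexp_def powr_def mult_ac flip: exp_of_nat_mult)
  qed
  then show ?thesis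
    unfolding partition_sum_def index total_sum_def by (intro infsum_cong) auto
qed

text \<open>The derivative of a similarity has the same norm everywhere. The supremum is over a nonempty set,
  since some path starts at \<open>u\<close>.\<close>
lemma edge_weight_eq:
  assumes "edge v u"
  shows "edge_weight S s v u = ennreal (((1 / 2) ^ v) powr s)"
proof -
  have "1 \<le> u" using assms edge_ge_1 by blast
  then obtain \<omega> where \<omega>: "walk_path \<omega>" "initial \<omega> 0 = [u]" using ex_walk_path[of "[u]"] by auto
  have "coding_map S \<omega> \<in> limit_set S \<inter> seed S u"
    using coding_map_in_cell[OF \<omega>(1), of 0] \<omega> \<open>1 \<le> u\<close> cell_singleton
    by (auto simp: limit_set_def path_space_eq)
  then have "limit_set S \<inter> seed S u \<noteq> {}" by blast
  moreover have "similarity ((1 / 2) ^ v) (emap S v u)"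
    using assms by (intro similarity) (simp add: edges_iff)
  ultimately show ?thesis
    by (simp add: edge_weight_def lower_norm_jacobian_similarity)
qed

lemma I_vertex_eq: "I_vertex S = {0<..}"
proof -
  define q :: "real \<Rightarrow> real" where "q s = (1 / 2) powr s" for s
  have pw: "((1 / 2) ^ v) powr s = q s ^ v" for s and v :: nat
  proof -
    have "((1 / 2) ^ v) powr s = ((1 / 2) powr real v) powr s" by (simp add: powr_realpow)
    then show ?thesis by (simp add: q_def powr_power powr_powr mult.commute)
  qed
  have sup: "(SUP u\<in>{u. (v, u) \<in> edges S}. edge_weight S s v u) = ennreal (q s ^ v)" if "1 \<le> v" for s v
  proof -
    have ne: "{u. edge v u} \<noteq> {}" using that by (cases "v = 1") (auto simp: edge_def)
    have "(SUP u\<in>{u. edge v u}. edge_weight S s v u) = (SUP u\<in>{u. edge v u}. ennreal (q s ^ v))"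
      by (intro SUP_cong) (simp_all add: edge_weight_eq pw)
    then show ?thesis using ne by (simp add: edges_iff)
  qed
  have "(\<Sum>\<^sub>\<infinity>v\<in>vertices S. SUP u\<in>{u. (v, u) \<in> edges S}. edge_weight S s v u)
      = (\<Sum>v. ennreal (q s ^ Suc v))" for s
  proof -
    have "vertices S = range Suc" by (auto simp: vertices image_iff Suc_le_eq gr0_conv_Suc)
    moreover have "(\<Sum>\<^sub>\<infinity>v\<in>vertices S. SUP u\<in>{u. (v, u) \<in> edges S}. edge_weight S s v u)
        = (\<Sum>\<^sub>\<infinity>v\<in>vertices S. ennreal (q s ^ v))"
      by (intro infsum_cong) (simp add: sup vertices)
    ultimately show ?thesis
      using infsum_reindex[of Suc UNIV "\<lambda>v. ennreal (q s ^ v)"]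
      by (simp add: infsum_ennreal_nat o_def)
  qed
  moreover have "(\<Sum>v. ennreal (q s ^ Suc v)) < \<infinity>" if "0 < s" for s
  proof -
    have "q s < 1" "0 < q s" using that gr_one_powr[of 2 s] by (auto simp: q_def powr_divide)
    then have "summable (\<lambda>v. q s ^ Suc v)" by (subst summable_Suc_iff) (auto intro: summable_geometric)
    then show ?thesis using \<open>0 < q s\<close> by (subst suminf_ennreal2) auto
  qed
  moreover have "(\<Sum>v. ennreal (q 0 ^ Suc v)) = \<infinity>"
    using nn_integral_count_space_nat[of "\<lambda>_. 1"] by (simp add: q_def)
  ultimately show ?thesis
    unfolding I_vertex_def by (auto simp: le_less)
qed

lemma I_edge_eq: "I_edge S = {}"
proof -
  have "(\<Sum>\<^sub>\<infinity>(v, u)\<in>edges S. edge_weight S s v u) = \<infinity>" for s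
  proof -
    let ?b = "ennreal ((1 / 2) powr s)" and ?f = "\<lambda>(v, u). edge_weight S s v u"
    let ?A = "Pair 1 ` {1::nat..}"
    have "infsum ?f ?A = \<infinity>"
    proof (rule infsum_superconst_infinite_ennreal[of _ ?b])
      show "infinite ?A"
        using infinite_Ici[of "1::nat"] by (subst finite_image_iff) (auto simp: inj_on_def)
    qed (auto simp: edge_weight_eq edge_def)
    moreover have "infsum ?f ?A \<le> infsum ?f (edges S)"
      by (intro infsum_ennreal_subset) (auto simp: edges)
    ultimately show ?thesis by (simp add: top_unique)
  qed
  then show ?thesis by (simp add: I_edge_def)
qed

section \<open>Pressure\<close>

lemma pressure_eq:
  assumes "weight_eigenvalue (2 powr - t) y"
  shows "pressure S (\<lambda>\<omega>. t * vertex_potential S \<omega>) = ereal (- ln y)"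
proof -
  interpret weight_eigenvalue "2 powr - t" y by fact
  have "pressure S (\<lambda>\<omega>. t * vertex_potential S \<omega>) = ereal (ln (1 / y))"
    unfolding pressure_def
  proof (rule lim_ereal_eln_geometric)
    fix n
    show "ennreal (1 / y * (1 / y) ^ n) \<le> partition_sum S (\<lambda>\<omega>. t * vertex_potential S \<omega>) (Suc n)"
      using total_sum_ge[of n] by (simp add: partition_sum_eq)
    show "partition_sum S (\<lambda>\<omega>. t * vertex_potential S \<omega>) (Suc n) \<le> ennreal (C * (1 / y) ^ n)"
      using total_sum_le[of n] by (simp add: partition_sum_eq)
  qed (use y C_pos in auto)
  then show ?thesis using y by (simp add: ln_div)
qed

lemma pressure_eq_top: "t \<le> 0 \<Longrightarrow> pressure S (\<lambda>\<omega>. t * vertex_potential S \<omega>) = \<infinity>"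
  unfolding pressure_def
  by (rule lim_ereal_eln_top) (simp add: partition_sum_eq total_sum_eq_top ge_one_powr_ge_zero)

lemma pressure_zero_iff:
  assumes crit: "weight_eigenvalue (2 powr - s) 1"
  shows "pressure S (\<lambda>\<omega>. t * vertex_potential S \<omega>) = 0 \<longleftrightarrow> t = s"
proof (cases "t \<le> 0")
  case True
  then have "t \<noteq> s" using weight_eigenvalue.x(2)[OF crit] ge_one_powr_ge_zero[of 2 "- t"] by auto
  with True show ?thesis by (simp add: pressure_eq_top)
next
  case False
  then obtain y where y: "weight_eigenvalue (2 powr - t) y"
    using ex_weight_eigenvalue[of "2 powr - t"] by (auto simp: powr_minus inverse_less_1_iff)
  have "t = s" if "y = 1"
    using that weight_eigenvalue_antimono[OF y crit] weight_eigenvalue_antimono[OF crit y] by force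
  moreover have "0 < y" using y by (simp add: weight_eigenvalue_def)
  ultimately show ?thesis
    using pressure_eq[OF y] pressure_eq[OF crit] by (auto simp: zero_ereal_def)
qed

section \<open>Hausdorff dimension of the limit set\<close>

lemma diam_pow_cell: "0 < t \<Longrightarrow> diam_pow t (cell w) = ennreal (2 powr t) * ennreal ((2 powr - t) ^ sum_list w)"
  using radius_pos[of w]
  by (simp add: diam_pow_def cell_def powr_mult radius_powr flip: ennreal_mult)

lemma limit_set_subset_cells: "limit_set S \<subseteq> (\<Union>w\<in>walks n. cell w)"
proof
  fix p assume "p \<in> limit_set S"
  then obtain \<omega> where \<omega>: "walk_path \<omega>" "p = coding_map S \<omega>"
    by (auto simp: limit_set_def path_space_eq)
  have "initial \<omega> n \<in> walks n" using is_walk_initial[OF \<omega>(1)] by (simp add: walks_def)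
  then show "p \<in> (\<Union>w\<in>walks n. cell w)" using coding_map_in_cell[OF \<omega>(1)] \<omega>(2) by blast
qed

text \<open>The cells of the walks of \<open>n + 1\<close> vertices form covers with diameters tending to \<open>0\<close>, for which
  the sums of \<open>t\<close>-th powers decay like \<open>(1 / y) ^ n\<close>.\<close>
lemma hausdorff_measure_eq_0:
  assumes t: "0 < t" and eig: "weight_eigenvalue (2 powr - t) y" and y_gt_1: "1 < y"
  shows "hausdorff_measure t (limit_set S) = 0"
proof -
  interpret weight_eigenvalue "2 powr - t" y by fact
  have "(INF U\<in>delta_covers \<delta> (limit_set S). \<Sum>\<^sub>\<infinity>i\<in>UNIV. diam_pow t (U i)) \<le> 0" if \<delta>: "0 < \<delta>" for \<delta>
  proof (rule tendsto_lowerbound)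
    show "(\<lambda>n. ennreal (2 powr t * (C * (1 / y) ^ n))) \<longlonglongrightarrow> 0"
      using y_gt_1 unfolding ennreal_0[symmetric]
      by (intro tendsto_ennrealI) (auto intro!: tendsto_eq_intros LIMSEQ_power_zero simp: abs_if)
    obtain k where k: "(1 / 2) ^ k < \<delta>" using real_arch_pow_inv[of \<delta> "1 / 2"] \<delta> by auto
    have "(INF U\<in>delta_covers \<delta> (limit_set S). \<Sum>\<^sub>\<infinity>i\<in>UNIV. diam_pow t (U i))
        \<le> ennreal (2 powr t * (C * (1 / y) ^ n))" if "k \<le> n" for n
    proof -
      have "diameter (cell w) \<le> \<delta>" if "w \<in> walks n" for w
      proof -
        have "is_walk w" "length w = Suc n" using that by (auto simp: walks_def)
        then obtain \<omega> where "walk_path \<omega>" "initial \<omega> n = w" using ex_walk_path[of w] by auto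
        then have "radius w \<le> (1 / 2) ^ Suc n" using radius_initial_le by blast
        also have "\<dots> \<le> (1 / 2) ^ Suc k" using \<open>k \<le> n\<close> by (intro power_decreasing) auto
        finally show ?thesis using k radius_pos[of w] by (simp add: cell_def)
      qed
      then have "(INF U\<in>delta_covers \<delta> (limit_set S). \<Sum>\<^sub>\<infinity>i\<in>UNIV. diam_pow t (U i))
          \<le> (\<Sum>\<^sub>\<infinity>w\<in>walks n. diam_pow t (cell w))"
        using \<delta> by (intro hausdorff_premeasure_le_infsum limit_set_subset_cells) (auto simp: cell_def)
      also have "\<dots> = ennreal (2 powr t) * total_sum (2 powr - t) n"
        by (simp add: diam_pow_cell t infsum_ennreal_cmult total_sum_def)
      also have "\<dots> \<le> ennreal (2 powr t) * ennreal (C * (1 / y) ^ n)"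
        by (intro mult_left_mono total_sum_le) auto
      also have "\<dots> = ennreal (2 powr t * (C * (1 / y) ^ n))"
        using C_pos y by (simp flip: ennreal_mult)
      finally show ?thesis .
    qed
    then show "\<forall>\<^sub>F n in sequentially. (INF U\<in>delta_covers \<delta> (limit_set S). \<Sum>\<^sub>\<infinity>i\<in>UNIV. diam_pow t (U i))
        \<le> ennreal (2 powr t * (C * (1 / y) ^ n))"
      by (auto simp: eventually_sequentially)
  qed simp
  then have "hausdorff_measure t (limit_set S) \<le> 0"
    unfolding hausdorff_measure_def by (intro SUP_least) auto
  then show ?thesis by simp
qed

text \<open>The stopping cells that meet \<open>U\<close> are balls of radius between \<open>(1 / 2) ^ N * d\<close> and \<open>d\<close> with disjoint
  interiors, and they all lie within distance \<open>3 * d\<close> of any point of \<open>U\<close>.\<close>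
lemma card_stopping_cells_le:
  assumes U: "U \<noteq> {}" "bounded U" "diameter U \<le> d" and d: "0 < d" "d \<le> 1"
    and I: "I = {w \<in> stopping_walks N d. cell w \<inter> U \<noteq> {}}"
  shows "finite I" "real (card I) \<le> (3 * 2 ^ N) ^ CARD('d)"
proof -
  obtain z where z: "z \<in> U" using U by blast
  have disj: "open_cell w \<inter> open_cell w' = {}" if "w \<in> I" "w' \<in> I" "w \<noteq> w'" for w w'
    using that stopping_walks_prefix_free[of w N d w'] stopping_walks_prefix_free[of w' N d w]
    by (intro open_cells_disjoint) (auto simp: I stopping_walks_def)
  have rad: "(1 / 2) ^ N * d \<le> radius w" if "w \<in> I" for w
    using that stopping_walks_radius_ge d by (auto simp: I)
  have sub: "open_cell w \<subseteq> cball z (3 * d)" if w: "w \<in> I" for w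
  proof
    fix q assume q: "q \<in> open_cell w"
    obtain p where p: "p \<in> cell w" "p \<in> U" using w unfolding I by blast
    have "dist z p \<le> d" using diameter_bounded_bound[OF U(2) z p(2)] U(3) by simp
    moreover have "dist (centre S c w) p \<le> d" "dist (centre S c w) q \<le> d"
      using w p q by (auto simp: I stopping_walks_def cell_def open_cell_def)
    moreover have "dist z q \<le> dist z p + dist (centre S c w) p + dist (centre S c w) q"
      using dist_triangle[of z q p] dist_triangle3[of p q "centre S c w"] by simp
    ultimately show "q \<in> cball z (3 * d)" by simp
  qed
  note packed = card_packed_balls_le[of I "centre S c" radius "(1 / 2) ^ N * d" "3 * d" z,
      folded open_cell_def, OF disj rad _ _ sub]
  show "finite I" using packed(1) d by auto
  have "3 * d / ((1 / 2) ^ N * d) = 3 * 2 ^ N" using d by (simp add: field_simps)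
  then show "real (card I) \<le> (3 * 2 ^ N) ^ CARD('d)" using packed(2) d by auto
qed

lemma mass_stopping_cells_le:
  assumes U: "U \<noteq> {}" "bounded U" "diameter U \<le> d" and d: "0 < d" "d \<le> 1" and t: "0 \<le> t"
  shows "infsum (mass (2 powr - t)) {w \<in> stopping_walks N d. cell w \<inter> U \<noteq> {}}
      \<le> ennreal ((3 * 2 ^ N) ^ CARD('d)) * ennreal (d powr t)"
proof -
  let ?I = "{w \<in> stopping_walks N d. cell w \<inter> U \<noteq> {}}"
  note I = card_stopping_cells_le[OF U d refl, of N]
  have "mass (2 powr - t) w \<le> ennreal (d powr t)" if "w \<in> ?I" for w
  proof -
    have w: "w \<noteq> []" "radius w \<le> d" using that by (auto simp: stopping_walks_def)
    have "(2 powr - t) ^ (sum_list (butlast w) + triangular (last w)) \<le> (2 powr - t) ^ sum_list w"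
      using w(1) t le_triangular[of "last w"]
      by (intro power_decreasing) (auto simp: sum_list_butlast powr_minus inverse_le_1_iff ge_one_powr_ge_zero)
    also have "\<dots> = radius w powr t" by (simp add: radius_powr)
    also have "\<dots> \<le> d powr t" using w radius_pos[of w] t by (intro powr_mono2) auto
    finally show ?thesis by (simp add: mass_def ennreal_leI)
  qed
  then have "infsum (mass (2 powr - t)) ?I \<le> (\<Sum>w\<in>?I. ennreal (d powr t))"
    unfolding infsum_finite[OF I(1)] by (rule sum_mono)
  also have "\<dots> = ennreal (real (card ?I) * d powr t)"
    by (simp add: ennreal_mult ennreal_of_nat_eq_real_of_nat)
  also have "\<dots> \<le> ennreal ((3 * 2 ^ N) ^ CARD('d) * d powr t)"
    using I(2) by (intro ennreal_leI mult_right_mono) auto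
  finally show ?thesis by (simp add: ennreal_mult)
qed

text \<open>Mass distribution without a measure: the stopping cells that meet the members of a cover block
  all paths from \<open>1\<close> through the vertices up to \<open>N\<close>, so they have total mass at least \<open>x\<close>, while those that meet one
  member have mass at most a constant times the \<open>t\<close>-th power of its diameter, up to an arbitrarily
  small error.\<close>
lemma hausdorff_measure_neq_0:
  assumes t: "0 \<le> t" and N: "1 \<le> (\<Sum>u=1..N. (2 powr - t) ^ triangular u)"
  shows "hausdorff_measure t (limit_set S) \<noteq> 0"
proof -
  let ?x = "2 powr - t" and ?M = "ennreal ((3 * 2 ^ N) ^ CARD('d))"
  have M: "0 < ?M" "?M \<noteq> top" by auto
  have lower: "ennreal ?x \<le> ?M * (\<Sum>\<^sub>\<infinity>i\<in>UNIV. diam_pow t (U i))"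
    if U: "U \<in> delta_covers 1 (limit_set S)" for U
  proof (rule ennreal_le_epsilon)
    fix e :: real assume e: "0 < e"
    define \<epsilon> where "\<epsilon> = e / (3 * 2 ^ N) ^ CARD('d)"
    have \<epsilon>: "0 < \<epsilon>" using e by (simp add: \<epsilon>_def)
    have "\<exists>d. U i \<noteq> {} \<longrightarrow> 0 < d \<and> d \<le> 1 \<and> diameter (U i) \<le> d \<and>
        ennreal (d powr t) \<le> diam_pow t (U i) + ennreal (\<epsilon> * (1 / 2) ^ Suc i)" for i
      using ex_scale[OF t, of "U i" "\<epsilon> * (1 / 2) ^ Suc i"] U \<epsilon> by (cases "U i = {}") (auto simp: delta_covers_def)
    then obtain d where d: "\<And>i. U i \<noteq> {} \<Longrightarrow> 0 < d i \<and> d i \<le> 1 \<and> diameter (U i) \<le> d i \<and>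
        ennreal (d i powr t) \<le> diam_pow t (U i) + ennreal (\<epsilon> * (1 / 2) ^ Suc i)"
      by metis
    define I where "I i = {w \<in> stopping_walks N (d i). cell w \<inter> U i \<noteq> {}}" for i
    have "ennreal ?x \<le> infsum (mass ?x) (\<Union>i. I i)"
    proof (rule mass_cover_ge[OF _ N])
      fix \<omega> :: "nat \<Rightarrow> nat" assume \<omega>: "walk_path \<omega>" "\<And>n. \<omega> n \<le> N"
      then have "coding_map S \<omega> \<in> limit_set S" by (auto simp: limit_set_def path_space_eq)
      then obtain i where i: "coding_map S \<omega> \<in> U i" using U by (auto simp: delta_covers_def)
      then obtain n where "initial \<omega> n \<in> stopping_walks N (d i)"
        using ex_initial_stopping[OF \<omega>, of "d i"] d[of i] by auto
      then show "\<exists>n. initial \<omega> n \<in> (\<Union>i. I i)"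
        using i coding_map_in_cell[OF \<omega>(1)] by (auto simp: I_def)
    qed simp
    also have "\<dots> \<le> (\<Sum>i. infsum (mass ?x) (I i))" by (rule infsum_ennreal_UN_le)
    also have "\<dots> \<le> (\<Sum>i. ?M * (diam_pow t (U i) + ennreal (\<epsilon> * (1 / 2) ^ Suc i)))"
    proof (rule suminf_le)
      fix i
      show "infsum (mass ?x) (I i) \<le> ?M * (diam_pow t (U i) + ennreal (\<epsilon> * (1 / 2) ^ Suc i))"
      proof (cases "U i = {}")
        case False
        have "infsum (mass ?x) (I i) \<le> ?M * ennreal (d i powr t)"
          unfolding I_def using d[OF False] U t
          by (intro mass_stopping_cells_le False) (auto simp: delta_covers_def)
        also have "\<dots> \<le> ?M * (diam_pow t (U i) + ennreal (\<epsilon> * (1 / 2) ^ Suc i))"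
          using d[OF False] by (intro mult_left_mono) auto
        finally show ?thesis .
      qed (simp add: I_def)
    qed auto
    also have "\<dots> = ?M * ((\<Sum>i. diam_pow t (U i)) + (\<Sum>i. ennreal (\<epsilon> * (1 / 2) ^ Suc i)))"
      by (simp add: ennreal_suminf_cmult suminf_add[symmetric] del: power_Suc)
    also have "(\<Sum>i. ennreal (\<epsilon> * (1 / 2) ^ Suc i)) = ennreal \<epsilon>"
      using sums_mult[OF power_half_series, of \<epsilon>] \<epsilon> by (subst suminf_ennreal2) (auto simp: sums_iff)
    also have "?M * ((\<Sum>i. diam_pow t (U i)) + ennreal \<epsilon>) = ?M * (\<Sum>i. diam_pow t (U i)) + ennreal e"
      using \<epsilon> by (simp add: distrib_left \<epsilon>_def flip: ennreal_mult)
    finally show "ennreal ?x \<le> ?M * (\<Sum>\<^sub>\<infinity>i\<in>UNIV. diam_pow t (U i)) + ennreal e"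
      by (simp add: infsum_ennreal_nat)
  qed
  have "ennreal ?x / ?M \<le> (INF U\<in>delta_covers 1 (limit_set S). \<Sum>\<^sub>\<infinity>i\<in>UNIV. diam_pow t (U i))"
    using lower M by (intro INF_greatest divide_le_posI_ennreal) (auto simp: mult.commute)
  also have "\<dots> \<le> hausdorff_measure t (limit_set S)"
    unfolding hausdorff_measure_def by (rule SUP_upper) simp
  finally show ?thesis using M by (auto simp: ennreal_divide_eq_0_iff)
qed

text \<open>The eigenvalue \<open>1 / y\<close> is below \<open>1\<close> for exponents above \<open>s\<close>, while below \<open>s\<close> finitely many vertices
  suffice for the lower bound.\<close>
lemma hausdorff_dim_eq:
  assumes s: "0 < s" and crit: "weight_eigenvalue (2 powr - s) 1"
  shows "hausdorff_dim (limit_set S) = ereal s"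
proof (rule antisym)
  show "hausdorff_dim (limit_set S) \<le> ereal s"
  proof (rule ereal_le_epsilon2)
    fix e :: real assume e: "0 < e"
    let ?t = "s + e"
    have lt: "2 powr - ?t < 2 powr - s" using e by simp
    obtain y where y: "weight_eigenvalue (2 powr - ?t) y"
      using ex_weight_eigenvalue[OF _ less_trans[OF lt weight_eigenvalue.x(2)[OF crit]]] by auto
    then have "hausdorff_measure ?t (limit_set S) = 0"
      using s e weight_eigenvalue_antimono[OF y crit lt] by (intro hausdorff_measure_eq_0) auto
    then have "hausdorff_dim (limit_set S) \<le> ereal ?t"
      unfolding hausdorff_dim_def using s e by (intro Inf_lower) auto
    then show "hausdorff_dim (limit_set S) \<le> ereal s + ereal e" by simp
  qed
  show "ereal s \<le> hausdorff_dim (limit_set S)"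
    unfolding hausdorff_dim_def
  proof (rule Inf_greatest, clarsimp)
    fix t assume t: "0 \<le> t" "hausdorff_measure t (limit_set S) = 0"
    show "s \<le> t"
    proof (rule ccontr)
      assume "\<not> s \<le> t"
      then have "2 powr - s < 2 powr - t" by simp
      then obtain N where "1 \<le> (\<Sum>u=1..N. (2 powr - t) ^ triangular u)"
        using ex_partial_sum_ge_1[OF crit] by blast
      then show False using hausdorff_measure_neq_0[OF t(1)] t(2) by simp
    qed
  qed
qed

end

theorem theorem4p1:
  fixes S :: "(nat, real^'d) graph_system"
    and c :: "nat \<Rightarrow> real^'d"
  assumes vertices: "vertices S = {v. 1 \<le> v}"
    and edges: "edges S = {(v, u). v = 1 \<and> 1 \<le> u} \<union> {(v, u). 2 \<le> v \<and> u = v - 1}"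
    and seed: "\<And>v. v \<in> vertices S \<Longrightarrow> seed S v = cball (c v) (1 / 2 ^ v)"
    and nbhd: "\<And>v. v \<in> vertices S \<Longrightarrow> nbhd S v = ball (c v) 1"
    and centres: "\<And>v v'. v \<in> vertices S \<Longrightarrow> v' \<in> vertices S \<Longrightarrow> v \<noteq> v' \<Longrightarrow>
        interior (seed S v) \<inter> interior (seed S v') = {}"
    and similarity: "\<And>v u. (v, u) \<in> edges S \<Longrightarrow> similarity ((1 / 2) ^ v) (emap S v u)"
    and into: "\<And>v u. (v, u) \<in> edges S \<Longrightarrow> emap S v u ` seed S u \<subseteq> seed S v"
    and open_set_condition: "\<And>v u v' u'. (v, u) \<in> edges S \<Longrightarrow> (v', u') \<in> edges S \<Longrightarrow>
        (v, u) \<noteq> (v', u') \<Longrightarrow>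
        emap S v u ` interior (seed S u) \<inter> emap S v' u' ` interior (seed S u') = {}"
  shows "(\<exists>s::real. hausdorff_dim (limit_set S) = ereal s
            \<and> pressure S (\<lambda>\<omega>. s * vertex_potential S \<omega>) = 0
            \<and> (\<forall>t. pressure S (\<lambda>\<omega>. t * vertex_potential S \<omega>) = 0 \<longrightarrow> t = s))
         \<and> I_vertex S = {0<..} \<and> I_edge S = {}"
proof -
  interpret descending_system S c
    using vertices edges seed centres similarity into open_set_condition by unfold_locales
  obtain x where x: "weight_eigenvalue x 1" using ex_critical_weight by blast
  define s where "s = - log 2 x"
  have "2 powr - s = x" "0 < s"
    using weight_eigenvalue.x[OF x] by (simp_all add: s_def)
  then have s: "0 < s" "weight_eigenvalue (2 powr - s) 1" using x by simp_all
  show ?thesis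
    using hausdorff_dim_eq[OF s] pressure_zero_iff[OF s(2)] I_vertex_eq I_edge_eq by auto
qed

end
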